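(* Let $D\in\mathbb{N}$, $E_0,\ldots,E_D\in\mathbb{R}$ and $\beta\in\mathbb{R}$. For each $n\in\mathbb{N}$, there is a probability measure $P_n$ on $S_n$ such that the measures $\mu_N\pi_{n,N}^{-1}$ on $S_n$ (which are defined for all sufficiently large $N$) converge to $P_n$ in total variation as $N\to\infty$.
   Context: $\mathbb{N}=\{1,2,\ldots\}$. A plane tree (ordered tree) is a rooted tree in which the child subtrees of every vertex are linearly ordered; two plane trees are equal if there is a bijection of their vertices preserving the parent–child relation and the order of the children of each vertex. The branching number $\deg(v)$ of a vertex $v$ is its number of children; the height $h(v)$ of $v$ is its distance to the root; the height of a finite tree is the maximal height of its vertices. $\mathbb{T}_N=\mathbb{T}_N(D)$ is the set of all plane trees on $N$ vertices in which every vertex has branching number at most $D$. For a tree $T$ with vertex set $V(T)$ let $E(T)=\sum_{v\in V(T)}E_{\deg(v)}$. The probability measure $\mu_N$ on $\mathbb{T}_N$ is $\mu_N\{T\}=e^{-\beta E(T)}/Z_N$, where $Z_N=\sum_{T\in\mathbb{T}_N}e^{-\beta E(T)}$. For $T\in\mathbb{T}_N$, $\pi_{n,N}T$ is the subtree of $T$ spanned by all vertices of height at most $n$. $S_n$ is the (finite) set of all plane trees of height exactly $n$ with all branching numbers at most $D$. For $N$ sufficiently large (depending on $n$, $D$), every $T\in\mathbb{T}_N$ has height at least $n$, so $\pi_{n,N}$ maps $\mathbb{T}_N$ into $S_n$, and $\mu_N\pi_{n,N}^{-1}$ denotes the push-forward of $\mu_N$ under $\pi_{n,N}$. *)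

theory Defs
  imports "HOL-Probability.Probability"
begin

datatype plane_tree = Node (children: "plane_tree list")

text \<open>Vertices are addressed by the list of (0-based) child indices on the path from the root, so the
  root is \<open>[]\<close>, the children of \<open>v\<close> are the vertices of the form \<open>v @ [i]\<close>, and the height of
  \<open>v\<close> is its length.\<close>

fun subtree_at :: "plane_tree \<Rightarrow> nat list \<Rightarrow> plane_tree option" where
  "subtree_at T [] = Some T"
| "subtree_at (Node ts) (i # v) = (if i < length ts then subtree_at (ts ! i) v else None)"

definition vertices :: "plane_tree \<Rightarrow> nat list set" where
  "vertices T = {v. subtree_at T v \<noteq> None}"

definition branching :: "plane_tree \<Rightarrow> nat list \<Rightarrow> nat" where
  "branching T v = card {i. v @ [i] \<in> vertices T}"

definition tree_height :: "plane_tree \<Rightarrow> nat" where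
  "tree_height T = Max (length ` vertices T)"

lemma vertices_Node:
  "vertices (Node ts) = insert [] (\<Union>i<length ts. (#) i ` vertices (ts ! i))"
proof -
  have "v \<in> vertices (Node ts) \<longleftrightarrow> v \<in> insert [] (\<Union>i<length ts. (#) i ` vertices (ts ! i))" for v
    by (cases v) (auto simp: vertices_def)
  then show ?thesis by blast
qed

lemma finite_vertices: "finite (vertices T)"
  by (induction T) (auto simp: vertices_Node)

lemma Nil_in_vertices: "[] \<in> vertices T"
  by (simp add: vertices_def)

lemma Cons_in_vertices:
  "i # v \<in> vertices (Node ts) \<longleftrightarrow> i < length ts \<and> v \<in> vertices (ts ! i)"
  by (simp add: vertices_def)

lemma branching_Nil: "branching (Node ts) [] = length ts"
  by (simp add: branching_def Cons_in_vertices Nil_in_vertices)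

lemma vertices_inject: "vertices S = vertices T \<longleftrightarrow> S = T"
proof
  show "vertices S = vertices T \<Longrightarrow> S = T"
  proof (induction S arbitrary: T)
    case (Node ss)
    obtain ts where T: "T = Node ts" by (cases T)
    have len: "length ss = length ts"
      using Node.prems by (metis T branching_Nil branching_def)
    have "ss ! i = ts ! i" if i: "i < length ss" for i
    proof (rule Node.IH)
      show "ss ! i \<in> set ss" using i by simp
      show "vertices (ss ! i) = vertices (ts ! i)"
        using Node.prems i len unfolding T by (metis Cons_in_vertices subsetI subset_antisym)
    qed
    then show ?case using T len by (simp add: nth_equalityI)
  qed
qed simp

fun truncate_tree :: "nat \<Rightarrow> plane_tree \<Rightarrow> plane_tree" where
  "truncate_tree 0 T = Node []"
| "truncate_tree (Suc n) (Node ts) = Node (map (truncate_tree n) ts)"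

lemma vertices_truncate_tree:
  "vertices (truncate_tree n T) = {v \<in> vertices T. length v \<le> n}"
proof (induction n arbitrary: T)
  case 0
  then show ?case by (auto simp: vertices_Node Nil_in_vertices)
next
  case (Suc n)
  obtain ts where T: "T = Node ts" by (cases T)
  show ?case unfolding T by (auto simp: vertices_Node Suc.IH)
qed

definition trees :: "nat \<Rightarrow> nat \<Rightarrow> plane_tree set" where
  "trees D N = {T. card (vertices T) = N \<and> (\<forall>v\<in>vertices T. branching T v \<le> D)}"

definition trees_of_height :: "nat \<Rightarrow> nat \<Rightarrow> plane_tree set" where
  "trees_of_height D n = {T. tree_height T = n \<and> (\<forall>v\<in>vertices T. branching T v \<le> D)}"

definition energy :: "(nat \<Rightarrow> real) \<Rightarrow> plane_tree \<Rightarrow> real" where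
  "energy E T = (\<Sum>v\<in>vertices T. E (branching T v))"

definition partition_function :: "nat \<Rightarrow> (nat \<Rightarrow> real) \<Rightarrow> real \<Rightarrow> nat \<Rightarrow> real" where
  "partition_function D E \<beta> N = (\<Sum>T\<in>trees D N. exp (- \<beta> * energy E T))"

definition gibbs_measure :: "nat \<Rightarrow> (nat \<Rightarrow> real) \<Rightarrow> real \<Rightarrow> nat \<Rightarrow> plane_tree measure" where
  "gibbs_measure D E \<beta> N =
     point_measure (trees D N) (\<lambda>T. ennreal (exp (- \<beta> * energy E T) / partition_function D E \<beta> N))"

text \<open>Intended for finite measures on the same \<open>\<sigma>\<close>-algebra.\<close>

definition total_variation :: "'a measure \<Rightarrow> 'a measure \<Rightarrow> real" where
  "total_variation M M' = (SUP A\<in>sets M. \<bar>measure M A - measure M' A\<bar>)"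

end

theory Submission
  imports Defs "HOL-Real_Asymp.Real_Asymp"
begin

text \<open>
  Write \<open>F(N, m)\<close> for the total Boltzmann weight of the forests of \<open>m\<close> trees with \<open>N\<close> vertices, so
  that \<open>Z\<^sub>N = F(N, 1)\<close>, and \<open>\<phi>(z) = \<Sum>\<^sub>k exp(- \<beta> E\<^sub>k) z\<^sup>k\<close>. The trees that truncate to a given \<open>S\<close> arise by
  grafting a forest onto the top vertices of \<open>S\<close>; hence the push-forward gives \<open>S\<close> the mass
  \<open>c F(N - j, m) / F(N, 1)\<close> with \<open>c\<close>, \<open>j\<close>, \<open>m\<close> depending on \<open>S\<close> only, and it suffices that these ratios
  converge. Deleting the first root of a forest yields a recursion whose solution is Lagrange's
  formula \<open>N F(N, m) = m [z\<^sup>N] z\<^sup>m \<phi>(z)\<^sup>N\<close>. For \<open>D \<ge> 2\<close> there is \<open>\<tau> > 0\<close> with \<open>\<tau> \<phi>'(\<tau>) = \<phi>(\<tau>)\<close>, so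
  \<open>\<phi>(\<tau> z) / \<phi>(\<tau>)\<close> is a probability generating function of mean 1, and the local limit theorem
  (Fourier inversion and dominated convergence) gives \<open>F(N, m) \<sim> C m \<tau>\<^sup>m r\<^sup>-\<^sup>N N\<^sup>-\<^sup>3\<^sup>/\<^sup>2\<close>. As \<open>S\<^sub>n\<close> is finite,
  pointwise convergence is convergence in total variation and no mass is lost.
\<close>

section \<open>Recursive description of plane trees\<close>

fun vcount :: "plane_tree \<Rightarrow> nat" where
  "vcount (Node ts) = Suc (\<Sum>t\<leftarrow>ts. vcount t)"

fun deg_le :: "nat \<Rightarrow> plane_tree \<Rightarrow> bool" where
  "deg_le D (Node ts) \<longleftrightarrow> length ts \<le> D \<and> (\<forall>t\<in>set ts. deg_le D t)"

fun weight :: "(nat \<Rightarrow> real) \<Rightarrow> plane_tree \<Rightarrow> real" where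
  "weight w (Node ts) = w (length ts) * (\<Prod>t\<leftarrow>ts. weight w t)"

lemma branching_Cons:
  "i < length ts \<Longrightarrow> branching (Node ts) (i # v) = branching (ts ! i) v"
  by (simp add: branching_def Cons_in_vertices)

text \<open>Vertex count and energy are both sums over vertices, so this one splitting along the
  children of the root turns each into a recursion on trees.\<close>

lemma sum_vertices_Node:
  "(\<Sum>v\<in>vertices (Node ts). f v) =
     f [] + (\<Sum>i<length ts. \<Sum>v\<in>vertices (ts ! i). f (i # v))" for f :: "nat list \<Rightarrow> 'a :: comm_monoid_add"
proof -
  have "(\<Sum>v\<in>vertices (Node ts). f v) = f [] + sum f (\<Union>i<length ts. (#) i ` vertices (ts ! i))"
    unfolding vertices_Node by (subst sum.insert) (auto simp: finite_vertices)
  also have "sum f (\<Union>i<length ts. (#) i ` vertices (ts ! i)) =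
      (\<Sum>i<length ts. sum f ((#) i ` vertices (ts ! i)))"
    by (rule sum.UNION_disjoint) (auto simp: finite_vertices)
  also have "\<dots> = (\<Sum>i<length ts. \<Sum>v\<in>vertices (ts ! i). f (i # v))"
    by (rule sum.cong) (auto simp: sum.reindex inj_on_def)
  finally show ?thesis .
qed

lemma card_vertices: "card (vertices T) = vcount T"
proof (induction T)
  case (Node ts)
  have "card (vertices (Node ts)) = 1 + (\<Sum>i<length ts. card (vertices (ts ! i)))"
    using sum_vertices_Node[of "\<lambda>_. 1::nat" ts] by simp
  also have "(\<Sum>i<length ts. card (vertices (ts ! i))) = (\<Sum>i<length ts. vcount (ts ! i))"
    by (rule sum.cong) (auto intro: Node.IH)
  also have "\<dots> = (\<Sum>t\<leftarrow>ts. vcount t)"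
    by (simp add: sum_list_sum_nth atLeast0LessThan)
  finally show ?case by simp
qed

lemma deg_le_iff: "(\<forall>v\<in>vertices T. branching T v \<le> D) \<longleftrightarrow> deg_le D T"
proof (induction T)
  case (Node ts)
  have "(\<forall>v\<in>vertices (Node ts). branching (Node ts) v \<le> D) \<longleftrightarrow>
      length ts \<le> D \<and> (\<forall>i<length ts. \<forall>v\<in>vertices (ts ! i). branching (ts ! i) v \<le> D)"
    by (auto simp: vertices_Node branching_Nil branching_Cons)
  also have "\<dots> \<longleftrightarrow> length ts \<le> D \<and> (\<forall>i<length ts. deg_le D (ts ! i))"
    using Node.IH by simp
  finally show ?case by (simp add: all_set_conv_all_nth)
qed

text \<open>The exponential makes the additive energy multiplicative over child subtrees, which is
  the form in which weights of forests can be summed.\<close>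

lemma exp_energy: "exp (- \<beta> * energy E T) = weight (\<lambda>k. exp (- \<beta> * E k)) T"
proof (induction T)
  case (Node ts)
  have "energy E (Node ts) = E (length ts) + (\<Sum>i<length ts. energy E (ts ! i))"
    unfolding energy_def by (subst sum_vertices_Node) (simp add: branching_Nil branching_Cons)
  then have "exp (- \<beta> * energy E (Node ts)) =
      exp (- \<beta> * E (length ts)) * (\<Prod>i<length ts. exp (- \<beta> * energy E (ts ! i)))"
    by (simp only: distrib_left exp_add sum_distrib_left exp_sum finite_lessThan)
  also have "(\<Prod>i<length ts. exp (- \<beta> * energy E (ts ! i))) =
      (\<Prod>i<length ts. weight (\<lambda>k. exp (- \<beta> * E k)) (ts ! i))"
    using Node.IH[OF nth_mem] by simp
  also have "\<dots> = (\<Prod>t\<leftarrow>ts. weight (\<lambda>k. exp (- \<beta> * E k)) t)"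
    by (induction ts) (simp_all add: prod.lessThan_Suc_shift del: prod.lessThan_Suc)
  finally show ?case by simp
qed

lemma weight_pos: "(\<And>k. w k > 0) \<Longrightarrow> weight w T > 0"
proof (induction T)
  case (Node ts)
  then have "(\<Prod>t\<leftarrow>ts. weight w t) > 0"
    by (induction ts) auto
  with Node.prems show ?case by simp
qed

lemma trees_eq: "trees D N = {T. vcount T = N \<and> deg_le D T}"
  by (simp add: trees_def card_vertices deg_le_iff)

section \<open>Height, truncation and finiteness of sets of trees\<close>

lemma tree_height_le_iff: "tree_height T \<le> n \<longleftrightarrow> (\<forall>v\<in>vertices T. length v \<le> n)"
  unfolding tree_height_def using Nil_in_vertices[of T] finite_vertices[of T]
  by (subst Max_le_iff) auto

lemma tree_height_Node_le:
  "tree_height (Node ts) \<le> Suc n \<longleftrightarrow> (\<forall>t\<in>set ts. tree_height t \<le> n)"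
  by (auto simp: tree_height_le_iff vertices_Node all_set_conv_all_nth)

text \<open>A tree of height at most \<open>Suc n\<close> is a list of at most \<open>D\<close>
  trees of height at most \<open>n\<close>. The finiteness of \<open>trees_of_height\<close> and
  \<open>forests\<close> and the threshold on \<open>N\<close> for truncation all rest on
  this.\<close>

lemma finite_deg_le_height_le: "finite {T. deg_le D T \<and> tree_height T \<le> n}"
proof (induction n)
  case 0
  have "T = Node []" if "tree_height T \<le> 0" for T
  proof (cases T)
    case (Node ts)
    have "ts = []"
    proof (rule ccontr)
      assume "ts \<noteq> []"
      then have "[0] \<in> vertices T" using Node by (simp add: Cons_in_vertices Nil_in_vertices)
      moreover have "length v \<le> 0" if "v \<in> vertices T" for v
        using \<open>tree_height T \<le> 0\<close> that unfolding tree_height_le_iff by blast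
      ultimately show False by force
    qed
    with Node show ?thesis by simp
  qed
  then have "{T. deg_le D T \<and> tree_height T \<le> 0} \<subseteq> {Node []}" by blast
  then show ?case by (rule finite_subset) simp
next
  case (Suc n)
  let ?X = "{T. deg_le D T \<and> tree_height T \<le> n}"
  have "{T. deg_le D T \<and> tree_height T \<le> Suc n} \<subseteq> Node ` {ts. set ts \<subseteq> ?X \<and> length ts \<le> D}"
  proof
    fix T assume "T \<in> {T. deg_le D T \<and> tree_height T \<le> Suc n}"
    then show "T \<in> Node ` {ts. set ts \<subseteq> ?X \<and> length ts \<le> D}"
      by (cases T) (auto simp: tree_height_Node_le)
  qed
  with finite_lists_length_le[OF Suc.IH] show ?case
    by (meson finite_imageI finite_subset)
qed

lemma finite_trees_of_height: "finite (trees_of_height D n)"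
  by (rule finite_subset[OF _ finite_deg_le_height_le[of D n]])
     (auto simp: trees_of_height_def deg_le_iff)

lemma tree_height_truncate_tree:
  assumes "n \<le> tree_height T"
  shows "tree_height (truncate_tree n T) = n"
proof -
  have "tree_height T \<in> length ` vertices T"
    unfolding tree_height_def using Nil_in_vertices[of T] finite_vertices[of T]
    by (intro Max_in) auto
  then obtain v where v: "v \<in> vertices T" "length v = tree_height T" by force
  \<comment> \<open>Ancestors of a vertex are vertices; cutting the address of a highest vertex at
    length \<open>n\<close> thus gives a vertex of height exactly \<open>n\<close>.\<close>
  have prefix: "take k u \<in> vertices S" if "u \<in> vertices S" for k u S
    using that
  proof (induction u arbitrary: k S)
    case (Cons i u)
    then show ?case
      by (cases S; cases k) (auto simp: Cons_in_vertices Nil_in_vertices)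
  qed (simp add: Nil_in_vertices)
  show ?thesis
    unfolding tree_height_def vertices_truncate_tree
  proof (rule Max_eqI)
    show "n \<in> length ` {v \<in> vertices T. length v \<le> n}"
      using prefix[OF v(1), of n] v(2) assms by (intro image_eqI[of _ _ "take n v"]) simp_all
  qed (use finite_vertices in auto)
qed

lemma deg_le_truncate_tree: "deg_le D T \<Longrightarrow> deg_le D (truncate_tree n T)"
  by (induction n T rule: truncate_tree.induct) auto

lemma truncate_tree_id: "tree_height T \<le> n \<Longrightarrow> truncate_tree n T = T"
  unfolding tree_height_le_iff vertices_inject[symmetric] vertices_truncate_tree by blast

lemma eventually_truncate_tree_in:
  "\<forall>\<^sub>F N in sequentially. \<forall>T\<in>trees D N. truncate_tree n T \<in> trees_of_height D n"
proof -
  let ?X = "{T. deg_le D T \<and> tree_height T \<le> n}"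
  \<comment> \<open>Beyond the largest size in the finite set \<open>?X\<close>, every tree in
    \<open>trees D N\<close> has height above \<open>n\<close>.\<close>
  have "\<forall>T\<in>trees D N. truncate_tree n T \<in> trees_of_height D n" if N: "N > Max (vcount ` ?X)" for N
  proof
    fix T assume T: "T \<in> trees D N"
    have "T \<notin> ?X"
    proof
      assume "T \<in> ?X"
      then have "vcount T \<le> Max (vcount ` ?X)"
        using finite_deg_le_height_le by (intro Max_ge) auto
      with T N show False by (simp add: trees_eq)
    qed
    then show "truncate_tree n T \<in> trees_of_height D n"
      using T by (auto simp: trees_eq trees_of_height_def deg_le_iff deg_le_truncate_tree
          tree_height_truncate_tree)
  qed
  then show ?thesis
    unfolding eventually_at_top_dense by blast
qed

section \<open>Weighted forests and Lagrange's formula\<close>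

text \<open>Deleting the root of a tree leaves a list of trees, so a closed recursion needs ordered
  forests, with the number \<open>m\<close> of components as a second parameter.\<close>

definition forests :: "nat \<Rightarrow> nat \<Rightarrow> nat \<Rightarrow> plane_tree list set" where
  "forests D N m = {ts. length ts = m \<and> (\<forall>t\<in>set ts. deg_le D t) \<and> (\<Sum>t\<leftarrow>ts. vcount t) = N}"

definition forest_sum :: "nat \<Rightarrow> (nat \<Rightarrow> real) \<Rightarrow> nat \<Rightarrow> nat \<Rightarrow> real" where
  "forest_sum D w N m = (\<Sum>ts\<in>forests D N m. \<Prod>t\<leftarrow>ts. weight w t)"

lemma vcount_pos: "vcount T > 0"
  by (cases T) simp

lemma length_le_sum_vcount: "length ts \<le> (\<Sum>t\<leftarrow>ts. vcount t)"
proof (induction ts)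
  case (Cons t ts)
  then show ?case using vcount_pos[of t] by simp
qed simp

text \<open>Bounds heights by sizes, so that \<open>finite_deg_le_height_le\<close> applies to the
  components of a forest.\<close>

lemma tree_height_less_vcount: "tree_height T < vcount T"
proof (induction T)
  case (Node ts)
  show ?case
  proof (cases ts)
    case Nil
    then show ?thesis by (simp add: tree_height_def vertices_Node)
  next
    case (Cons t us)
    have "tree_height t \<le> (\<Sum>t\<leftarrow>ts. vcount t) - 1" if "t \<in> set ts" for t
      using Node[OF that] member_le_sum_list[of "vcount t" "map vcount ts"] that by simp
    then have "tree_height (Node ts) \<le> Suc ((\<Sum>t\<leftarrow>ts. vcount t) - 1)"
      by (subst tree_height_Node_le) auto
    moreover have "(\<Sum>t\<leftarrow>ts. vcount t) > 0" using Cons vcount_pos by simp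
    ultimately show ?thesis by simp
  qed
qed

lemma finite_forests: "finite (forests D N m)"
proof (rule finite_subset)
  show "forests D N m \<subseteq> {ts. set ts \<subseteq> {T. deg_le D T \<and> tree_height T \<le> N} \<and> length ts \<le> m}"
  proof safe
    fix ts t assume ts: "ts \<in> forests D N m" "t \<in> set ts"
    then have "vcount t \<le> N"
      using member_le_sum_list[of "vcount t" "map vcount ts"] by (auto simp: forests_def)
    then show "tree_height t \<le> N" using tree_height_less_vcount[of t] by simp
  qed (auto simp: forests_def)
qed (intro finite_lists_length_le finite_deg_le_height_le)

lemma forest_sum_0: "forest_sum D w N 0 = (if N = 0 then 1 else 0)"
proof -
  have "forests D N 0 = (if N = 0 then {[]} else {})"
    by (auto simp: forests_def)
  then show ?thesis by (simp add: forest_sum_def)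
qed

lemma forest_sum_eq_0: "N < m \<Longrightarrow> forest_sum D w N m = 0"
proof -
  assume "N < m"
  then have "ts \<notin> forests D N m" for ts
    using length_le_sum_vcount[of ts] by (auto simp: forests_def)
  then have "forests D N m = {}" by blast
  then show ?thesis by (simp add: forest_sum_def)
qed

text \<open>Remove the root of the first tree and put its \<open>k\<close> child subtrees in front
  of the other trees: one vertex and the factor \<open>w k\<close> disappear, and
  \<open>m + k\<close> trees remain.\<close>

lemma forest_sum_Suc:
  "forest_sum D w (Suc N) (Suc m) = (\<Sum>k\<le>D. w k * forest_sum D w N (m + k))"
proof -
  \<comment> \<open>The inverse operation: the first \<open>k\<close> trees are grafted onto a new
    root.\<close>
  define \<Phi> where "\<Phi> k ts = Node (take k ts) # drop k ts" for k ts
  have inj: "inj_on (\<Phi> k) (forests D N (m + k))" for k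
  proof (rule inj_onI)
    fix ts us assume "\<Phi> k ts = \<Phi> k us"
    then have "take k ts = take k us" "drop k ts = drop k us" by (simp_all add: \<Phi>_def)
    then show "ts = us" by (metis append_take_drop_id)
  qed
  have un: "forests D (Suc N) (Suc m) = (\<Union>k\<le>D. \<Phi> k ` forests D N (m + k))"
  proof (intro equalityI subsetI)
    fix ts assume ts: "ts \<in> forests D (Suc N) (Suc m)"
    then obtain t vs where "ts = t # vs"
      by (cases ts) (auto simp: forests_def)
    moreover obtain us where "t = Node us" by (cases t)
    ultimately have [simp]: "ts = Node us # vs" by simp
    show "ts \<in> (\<Union>k\<le>D. \<Phi> k ` forests D N (m + k))"
    proof (rule UN_I)
      show "length us \<in> {..D}" using ts by (simp add: forests_def)
      show "ts \<in> \<Phi> (length us) ` forests D N (m + length us)"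
      proof (rule image_eqI)
        show "ts = \<Phi> (length us) (us @ vs)" by (simp add: \<Phi>_def)
        show "us @ vs \<in> forests D N (m + length us)" using ts by (auto simp: forests_def)
      qed
    qed
  next
    fix ts assume "ts \<in> (\<Union>k\<le>D. \<Phi> k ` forests D N (m + k))"
    then obtain k us where k: "k \<le> D" "us \<in> forests D N (m + k)" "ts = \<Phi> k us" by auto
    have "(\<Sum>t\<leftarrow>take k us. vcount t) + (\<Sum>t\<leftarrow>drop k us. vcount t) = (\<Sum>t\<leftarrow>us. vcount t)"
      by (metis append_take_drop_id map_append sum_list_append)
    with k show "ts \<in> forests D (Suc N) (Suc m)"
      by (simp add: forests_def \<Phi>_def) (meson in_set_takeD in_set_dropD)
  qed
  \<comment> \<open>The degree of the first root recovers \<open>k\<close>.\<close>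
  have disj: "\<Phi> k ` forests D N (m + k) \<inter> \<Phi> l ` forests D N (m + l) = {}" if "k \<noteq> l" for k l
  proof (rule equals0I)
    fix ts assume ts: "ts \<in> \<Phi> k ` forests D N (m + k) \<inter> \<Phi> l ` forests D N (m + l)"
    have len: "length (children (hd ts)) = i" if "ts \<in> \<Phi> i ` forests D N (m + i)" for i
      using that by (auto simp: \<Phi>_def forests_def)
    from len[OF IntD1[OF ts]] len[OF IntD2[OF ts]] have "k = l" by simp
    with \<open>k \<noteq> l\<close> show False by simp
  qed
  have "forest_sum D w (Suc N) (Suc m) =
      (\<Sum>k\<le>D. \<Sum>ts\<in>\<Phi> k ` forests D N (m + k). \<Prod>t\<leftarrow>ts. weight w t)"
    unfolding forest_sum_def un
  proof (rule sum.UNION_disjoint[of "{..D}" "\<lambda>k. \<Phi> k ` forests D N (m + k)"])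
    show "finite {..D}" by (rule finite_atMost)
    show "\<forall>k\<in>{..D}. finite (\<Phi> k ` forests D N (m + k))"
      by (intro ballI finite_imageI finite_forests)
    show "\<forall>k\<in>{..D}. \<forall>l\<in>{..D}. k \<noteq> l \<longrightarrow>
        \<Phi> k ` forests D N (m + k) \<inter> \<Phi> l ` forests D N (m + l) = {}"
      by (intro ballI impI) (rule disj)
  qed
  also have "\<dots> = (\<Sum>k\<le>D. w k * forest_sum D w N (m + k))"
  proof (rule sum.cong)
    fix k
    have "(\<Prod>t\<leftarrow>\<Phi> k ts. weight w t) = w k * (\<Prod>t\<leftarrow>ts. weight w t)"
      if "ts \<in> forests D N (m + k)" for ts
    proof -
      have "(\<Prod>t\<leftarrow>take k ts. weight w t) * (\<Prod>t\<leftarrow>drop k ts. weight w t) = (\<Prod>t\<leftarrow>ts. weight w t)"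
        by (metis append_take_drop_id map_append prod_list.append)
      with that show ?thesis by (simp add: \<Phi>_def forests_def mult.assoc)
    qed
    then show "(\<Sum>ts\<in>\<Phi> k ` forests D N (m + k). \<Prod>t\<leftarrow>ts. weight w t) = w k * forest_sum D w N (m + k)"
      unfolding forest_sum_def by (simp add: sum.reindex[OF inj] sum_distrib_left)
  qed simp
  finally show ?thesis .
qed

section \<open>The offspring polynomial and Lagrange's formula\<close>

definition offspring_poly :: "nat \<Rightarrow> (nat \<Rightarrow> real) \<Rightarrow> real poly" where
  "offspring_poly D w = (\<Sum>k\<le>D. monom (w k) k)"

lemma coeff_offspring_poly: "coeff (offspring_poly D w) k = (if k \<le> D then w k else 0)"
  by (simp add: offspring_poly_def coeff_sum)

text \<open>The factor \<open>N\<close> avoids a division by zero, and the monomial makes both sides vanish for \<open>N < m\<close>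
  where a truncated \<open>N - m\<close> would not.\<close>

lemma forest_sum_lagrange:
  "real N * forest_sum D w N m = real m * coeff (monom 1 m * offspring_poly D w ^ N) N"
proof (induction N arbitrary: m)
  case 0
  then show ?case by simp
next
  case (Suc N)
  let ?\<phi> = "offspring_poly D w"
  let ?c = "\<lambda>k. coeff (?\<phi> ^ Suc N) k"
  show ?case
  proof (cases m)
    case 0
    then show ?thesis by (simp add: forest_sum_0)
  next
    case m: (Suc l)
    show ?thesis
    \<comment> \<open>The induction hypothesis only controls
      \<open>real N * forest_sum D w N (l + k)\<close>, so the recursion is multiplied by
      \<open>N\<close> and the factor cancelled at the end; \<open>N = 0\<close> is therefore
      computed by hand.\<close>
    proof (cases "N = 0")
      case True
      have "(\<Sum>k\<le>D. w k * forest_sum D w 0 (l + k)) = (\<Sum>k\<le>D. if k = 0 then (if l = 0 then w 0 else 0) else 0)"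
        by (rule sum.cong) (auto simp: forest_sum_0 forest_sum_eq_0)
      then show ?thesis using True m 
        by (auto simp: forest_sum_Suc coeff_monom_mult coeff_offspring_poly)
    next
      case N: False
      have deriv: "pderiv ?\<phi> = (\<Sum>k\<le>D. monom (real k * w k) (k - 1))"
        unfolding offspring_poly_def by (simp add: higher_pderiv_sum[of 1, simplified] pderiv_monom)
      have "real N * forest_sum D w (Suc N) (Suc l) =
          (\<Sum>k\<le>D. w k * (real N * forest_sum D w N (l + k)))"
        by (simp add: forest_sum_Suc sum_distrib_left algebra_simps)
      also have "\<dots> = (\<Sum>k\<le>D. w k * (real (l + k) * coeff (monom 1 (l + k) * ?\<phi> ^ N) N))"
        by (simp only: Suc.IH)
      \<comment> \<open>The factor \<open>l + k\<close> splits: \<open>l\<close> yields l z^l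
        \<phi>, and \<open>k\<close> yields z^(l+1) \<phi>', the derivative bringing down the
        exponent.\<close>
      also have "\<dots> = coeff (monom (real l) l * ?\<phi> * ?\<phi> ^ N +
          monom 1 (Suc l) * pderiv ?\<phi> * ?\<phi> ^ N) N"
      proof -
        have "monom 1 (Suc l) * pderiv ?\<phi> = (\<Sum>k\<le>D. monom (real k * w k) (l + k))"
          unfolding deriv sum_distrib_left
        proof (rule sum.cong)
          fix k
          show "monom 1 (Suc l) * monom (real k * w k) (k - 1) = monom (real k * w k) (l + k)"
            by (cases k) (simp_all add: mult_monom)
        qed simp
        moreover have "monom (real l) l * ?\<phi> = (\<Sum>k\<le>D. monom (real l * w k) (l + k))"
          unfolding offspring_poly_def sum_distrib_left by (simp add: mult_monom)
        ultimately have "monom (real l) l * ?\<phi> * ?\<phi> ^ N + monom 1 (Suc l) * pderiv ?\<phi> * ?\<phi> ^ N =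
            (\<Sum>k\<le>D. monom (real (l + k) * w k) (l + k) * ?\<phi> ^ N)"
          by (simp add: sum_distrib_right distrib_right flip: sum.distrib add_monom)
        then show ?thesis
          by (simp add: coeff_sum coeff_monom_mult) (intro sum.cong; simp)
      qed
      \<comment> \<open>Up to the factor N + 1, \<phi>' \<phi>^N is the derivative of \<phi>^(N+1),
        so only one power of \<phi> remains.\<close>
      also have "real (Suc N) * \<dots> = coeff (smult (real (Suc N)) (monom (real l) l * ?\<phi> ^ Suc N) +
          monom 1 (Suc l) * pderiv (?\<phi> ^ Suc N)) N"
      proof -
        have "pderiv (?\<phi> ^ Suc N) = smult (real (Suc N)) (pderiv ?\<phi> * ?\<phi> ^ N)"
          by (simp del: power_Suc add: pderiv_power_Suc mult.commute)
        then show ?thesis by (simp only:) (simp add: algebra_simps)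
      qed
      \<comment> \<open>The coefficient of z^(N-l) in \<phi>^(N+1) occurs with total factor (N+1) l
        + (N-l) = N (l+1).\<close>
      also have "\<dots> = (if l \<le> N then real N * real (Suc l) * ?c (N - l) else 0)"
      proof (cases "Suc l \<le> N")
        case True
        then have "Suc (N - Suc l) = N - l" by simp
        moreover have "real (N - l) = real N - real l" using True by simp
        ultimately show ?thesis using True
          by (simp del: power_Suc add: coeff_monom_mult coeff_pderiv algebra_simps)
      next
        case False
        then show ?thesis 
          by (cases "l = N") (simp_all del: power_Suc add: coeff_monom_mult)
      qed
      also have "\<dots> = real N * (real (Suc l) * coeff (monom 1 (Suc l) * ?\<phi> ^ Suc N) (Suc N))"
        by (simp del: power_Suc add: coeff_monom_mult)
      finally show ?thesis using N m by (simp del: power_Suc)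
    qed
  qed
qed

section \<open>A local limit theorem\<close>

text \<open>With x = |t|/2 one has cos t = 1 - 2 sin^2 x, and x/2 \<le> sin x on [0, 8/5], which
  contains [0, pi/2]. The constant is not sharp; what matters is validity on the whole
  period.\<close>

lemma cos_le_quadratic:
  fixes t :: real
  assumes "\<bar>t\<bar> \<le> pi"
  shows "cos t \<le> 1 - t\<^sup>2 / 8"
proof -
  define x where "x = \<bar>t\<bar> / 2"
  have x: "0 \<le> x" "x \<le> 8 / 5"
    using assms pi_less_4 pi_approx by (auto simp: x_def)
  have "\<bar>sin x - x\<bar> \<le> x ^ 3 / 6"
    using Maclaurin_sin_bound[of x 3] x by (simp add: eval_nat_numeral sin_coeff_def fact_numeral)
  moreover have "x ^ 3 / 6 \<le> x / 2"
  proof -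
    have "x\<^sup>2 \<le> (8 / 5)\<^sup>2" using x by (intro power_mono)
    then have "x * x\<^sup>2 \<le> x * 3" using x by (intro mult_left_mono) (auto simp: power2_eq_square)
    then show ?thesis by (simp add: power3_eq_cube power2_eq_square)
  qed
  ultimately have "x / 2 \<le> sin x" by linarith
  then have "(x / 2)\<^sup>2 \<le> (sin x)\<^sup>2" using x by (intro power_mono) auto
  moreover have "cos t = 1 - 2 * (sin x)\<^sup>2"
    using cos_double_sin[of x] by (cases "t \<ge> 0") (auto simp: x_def)
  ultimately show ?thesis by (simp add: x_def power_divide)
qed

section \<open>Fourier coefficients of polynomials on the unit circle\<close>

definition poly_cis :: "real poly \<Rightarrow> real \<Rightarrow> complex" where
  "poly_cis p t = poly (map_poly of_real p) (cis t)"

lemma poly_cis_mult: "poly_cis (p * q) t = poly_cis p t * poly_cis q t"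
proof -
  have "map_poly complex_of_real (p * q) = map_poly of_real p * map_poly of_real q"
    by (rule poly_eqI) (simp add: coeff_map_poly coeff_mult)
  then show ?thesis by (simp add: poly_cis_def)
qed

lemma poly_cis_power: "poly_cis (p ^ n) t = poly_cis p t ^ n"
  by (induction n) (auto simp: poly_cis_mult, simp add: poly_cis_def one_pCons map_poly_pCons)

lemma poly_cis_altdef: "poly_cis p t = (\<Sum>k\<le>degree p. of_real (coeff p k) * cis (real k * t))"
  by (simp add: poly_cis_def poly_altdef coeff_map_poly degree_map_poly Complex.DeMoivre)

lemma continuous_poly_cis [continuous_intros]: "continuous_on A (poly_cis p)"
  unfolding poly_cis_altdef[abs_def] cis_conv_exp by (intro continuous_intros)

text \<open>Orthogonality of characters: for nonzero \<open>j\<close> the antiderivative takes equal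
  values at both ends of the period.\<close>

lemma has_bochner_integral_cis:
  "has_bochner_integral lborel (\<lambda>t. indicator {-pi..pi} t *\<^sub>R cis (of_int j * t))
     (if j = 0 then of_real (2 * pi) else 0)"
proof (cases "j = 0")
  case True
  have "has_bochner_integral lborel (\<lambda>t::real. indicator {-pi..pi} t *\<^sub>R (1::complex)) (of_real pi - of_real (-pi))"
    by (rule has_bochner_integral_FTC_Icc) (auto intro!: derivative_eq_intros continuous_intros simp: has_vector_derivative_of_real)
  with True show ?thesis by simp
next
  case False
  define F where "F t = cis (of_int j * t) / (\<i> * of_int j)" for t
  have "(F has_vector_derivative cis (of_int j * t)) (at t within {-pi..pi})" for t
  proof -
    have "cis (of_int j * x) = exp (x *\<^sub>R (\<i> * of_int j))" for x
      by (simp add: cis_conv_exp scaleR_conv_of_real mult_ac)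
    with exp_scaleR_has_vector_derivative_right[of "\<i> * of_int j" t "{-pi..pi}", THEN has_vector_derivative_divide, of "\<i> * of_int j"] False
    show ?thesis by (simp add: F_def[abs_def])
  qed
  then have "has_bochner_integral lborel (\<lambda>t. indicator {-pi..pi} t *\<^sub>R cis (of_int j * t)) (F pi - F (-pi))"
    by (intro has_bochner_integral_FTC_Icc) (auto intro!: continuous_intros simp: cis_conv_exp)
  moreover have "cis (of_int j * pi) = cis (of_int j * (- pi))"
    by (simp add: cis.ctr sin_integer_2pi complex_eq_iff mult.commute[of _ pi] sin_npi_int)
  ultimately show ?thesis using False by (simp add: F_def)
qed

text \<open>Fourier inversion: multiplying by the conjugate of the \<open>k\<close>-th character
  leaves only the \<open>k\<close>-th term. For \<open>k\<close> above the degree the value is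
  0.\<close>

lemma has_bochner_integral_poly_cis_coeff:
  "has_bochner_integral lborel (\<lambda>t. indicator {-pi..pi} t *\<^sub>R (poly_cis p t * cis (- (real k * t))))
     (of_real (2 * pi * coeff p k))"
proof -
  have "has_bochner_integral lborel
     (\<lambda>t. \<Sum>i\<le>degree p. of_real (coeff p i) * (indicator {-pi..pi} t *\<^sub>R cis (of_int (int i - int k) * t)))
     (\<Sum>i\<le>degree p. of_real (coeff p i) * (if int i - int k = 0 then of_real (2 * pi) else 0))"
    by (intro has_bochner_integral_sum has_bochner_integral_mult_right has_bochner_integral_cis)
  also have "(\<lambda>t. \<Sum>i\<le>degree p. of_real (coeff p i) * (indicator {-pi..pi} t *\<^sub>R cis (of_int (int i - int k) * t))) =
     (\<lambda>t. indicator {-pi..pi} t *\<^sub>R (poly_cis p t * cis (- (real k * t))))"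
  proof
    fix t
    have "cis (of_int (int i - int k) * t) = cis (real i * t) * cis (- (real k * t))" for i
      by (simp add: cis_mult algebra_simps)
    then show "(\<Sum>i\<le>degree p. of_real (coeff p i) * (indicator {-pi..pi} t *\<^sub>R cis (of_int (int i - int k) * t))) =
       indicator {-pi..pi} t *\<^sub>R (poly_cis p t * cis (- (real k * t)))"
      by (simp add: poly_cis_altdef sum_distrib_right scaleR_sum_right mult.assoc)
  qed
  also have "(\<Sum>i\<le>degree p. of_real (coeff p i) * (if int i - int k = 0 then of_real (2 * pi) else 0)) =
      (complex_of_real (2 * pi * coeff p k))"
    by (simp add: if_distrib coeff_eq_0 cong: if_cong)
  finally show ?thesis .
qed

lemma has_bochner_integral_exp_neg_quadratic:
  fixes c :: real
  assumes "c > 0"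
  shows "has_bochner_integral lborel (\<lambda>x. exp (- c * x\<^sup>2)) (sqrt (pi / c))"
proof -
  \<comment> \<open>The standard deviation whose normal density is proportional to
    \<open>exp (- c * x\<^sup>2)\<close>.\<close>
  define s where "s = sqrt (1 / (2 * c))"
  have s: "s > 0" "s\<^sup>2 = 1 / (2 * c)" using assms by (simp_all add: s_def)
  have "has_bochner_integral lborel (\<lambda>x. sqrt (pi / c) * normal_density 0 s x) (sqrt (pi / c) * 1)"
    using s by (intro has_bochner_integral_mult_right) (simp add: has_bochner_integral_iff)
  also have "(\<lambda>x. sqrt (pi / c) * normal_density 0 s x) = (\<lambda>x. exp (- c * x\<^sup>2))"
    using assms by (simp add: normal_density_def s field_simps)
  finally show ?thesis by simp
qed

lemma norm_cis_taylor: "norm (cis x - (1 + \<i> * of_real x - of_real (x\<^sup>2 / 2))) \<le> \<bar>x\<bar> ^ 3 / 6"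
proof -
  have "(\<Sum>k\<le>2. (\<i> * complex_of_real x) ^ k / fact k) = 1 + \<i> * of_real x - of_real (x\<^sup>2 / 2)"
    by (simp add: numeral_2_eq_2 power_mult_distrib)
  then show ?thesis
    using iexp_approx1[of x 2] by (simp add: cis_conv_exp fact_numeral numeral_3_eq_3)
qed

lemma one_minus_le_exp: "1 - x \<le> exp (- x)" for x :: real
  using exp_ge_add_one_self[of "-x"] by simp

text \<open>For \<open>n \<ge> m\<close>, \<open>coeff (p ^ n) (n - m)\<close> is the probability
  that \<open>n\<close> independent steps with generating function \<open>p\<close> sum to
  \<open>n - m\<close>. The mean of the sum is \<open>n\<close>, so the point stays at bounded
  distance from the centre and \<open>L\<close> is the same for all \<open>m\<close>. The proof
  gives 1 / sqrt (2 pi \<sigma>), where \<sigma> is the variance of a step.\<close>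

lemma local_limit:
  fixes p :: "real poly"
  assumes nonneg: "\<And>k. coeff p k \<ge> 0"
    and pos: "coeff p 0 > 0" "coeff p 1 > 0"
    and total: "poly p 1 = 1" and mean: "poly (pderiv p) 1 = 1"
  obtains L where "L > 0" "\<And>m. (\<lambda>n. sqrt (real n) * coeff (p ^ n) (n - m)) \<longlonglongrightarrow> L"
proof -
  define d where "d = degree p"
  define a where "a k = coeff p k" for k
  \<comment> \<open>The characteristic function of a step minus its mean 1; below, \<sigma> is the
    variance and \<open>C\<close> a third absolute moment that controls the Taylor error.\<close>
  define \<psi> where "\<psi> t = poly_cis p t * cis (- t)" for t
  define \<sigma> where "\<sigma> = (\<Sum>k\<le>d. a k * (real k - 1)\<^sup>2)"
  define C where "C = (\<Sum>k\<le>d. a k * \<bar>real k - 1\<bar> ^ 3 / 6)"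
  define c where "c = a 0 * a 1 / 8"
  have a_nonneg: "a k \<ge> 0" for k using nonneg by (simp add: a_def)
  have a_pos: "a 0 > 0" "a 1 > 0" using pos by (simp_all add: a_def)
  have d: "d \<ge> 1" using pos(2) by (auto simp: d_def intro: le_degree)
  have sum_a: "(\<Sum>k\<le>d. a k) = 1"
    using total by (simp add: poly_altdef a_def d_def)
  have sum_ka: "(\<Sum>k\<le>d. a k * (real k - 1)) = 0"
  proof -
    have "poly (pderiv p) 1 = (\<Sum>k\<le>d. real k * a k)"
    proof -
      have "pderiv p = (\<Sum>k\<le>d. monom (real k * a k) (k - 1))"
        by (subst poly_as_sum_of_monoms[of p, symmetric])
           (simp add: higher_pderiv_sum[of 1, simplified] pderiv_monom a_def d_def)
      then show ?thesis by (simp add: poly_sum poly_monom)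
    qed
    then show ?thesis using mean sum_a by (simp add: algebra_simps sum_subtractf)
  qed
  have \<sigma>_pos: "\<sigma> > 0"
  proof -
    have "a 0 * (real 0 - 1)\<^sup>2 \<le> \<sigma>" unfolding \<sigma>_def
      by (rule member_le_sum) (use a_nonneg in auto)
    with a_pos show ?thesis by simp
  qed
  have c_pos: "c > 0" using a_pos by (simp add: c_def)

  have \<psi>_sum: "\<psi> t = (\<Sum>k\<le>d. of_real (a k) * cis ((real k - 1) * t))" for t
    by (simp add: \<psi>_def poly_cis_altdef a_def d_def sum_distrib_right cis_mult mult.assoc left_diff_distrib)

  \<comment> \<open>The weights of 0 and 1 alone rule out periodicity.\<close>
  have \<psi>_bound: "norm (\<psi> t) \<le> exp (- c * t\<^sup>2)" if t: "\<bar>t\<bar> \<le> pi" for t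
  proof -
    let ?q = "a 0 + a 1"
    have q: "?q \<le> 1"
    proof -
      have "?q = (\<Sum>k\<in>{0, 1}. a k)" by simp
      also have "\<dots> \<le> (\<Sum>k\<le>d. a k)" using d a_nonneg by (intro sum_mono2) auto
      finally show ?thesis using sum_a by simp
    qed
    have split: "{..d} = insert 0 (insert 1 {2..d})" using d by auto
    have "norm (\<psi> t) = norm (poly_cis p t)" by (simp add: \<psi>_def norm_mult)
    also have "poly_cis p t = (of_real (a 0) + of_real (a 1) * cis t) + (\<Sum>k=2..d. of_real (a k) * cis (real k * t))"
      unfolding poly_cis_altdef d_def[symmetric] a_def[symmetric] split by simp
    also have "norm \<dots> \<le> norm (of_real (a 0) + of_real (a 1) * cis t) + (\<Sum>k=2..d. norm (of_real (a k) * cis (real k * t)))"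
      by (intro norm_triangle_mono norm_sum order.refl)
    also have "(\<Sum>k=2..d. norm (of_real (a k) * cis (real k * t))) = (\<Sum>k=2..d. a k)"
      using a_nonneg by (simp add: norm_mult)
    also have "(\<Sum>k=2..d. a k) = 1 - ?q"
      using sum_a unfolding split by simp
    \<comment> \<open>Decay comes from the interference of the terms 0 and 1. The squared modulus is
      the square of \<open>?q\<close> minus \<open>2 * a 0 * a 1 * (1 - cos t)\<close>; since
      \<open>?q \<le> 1\<close>, the subtracted term may be multiplied by \<open>?q\<close>, which
      allows completing the square.\<close>
    also have "norm (of_real (a 0) + of_real (a 1) * cis t) \<le> ?q - a 0 * a 1 * (1 - cos t)"
    proof (rule power2_le_imp_le)
      let ?x = "1 - cos t"
      have "(norm (of_real (a 0) + of_real (a 1) * cis t))\<^sup>2 = (a 0 + a 1 * cos t)\<^sup>2 + (a 1 * sin t)\<^sup>2"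
        by (simp add: cmod_power2)
      also have "\<dots> = ?q\<^sup>2 - 2 * a 0 * a 1 * ?x"
        using sin_cos_squared_add[of t] by algebra
      also have "\<dots> \<le> ?q\<^sup>2 - 2 * ?q * (a 0 * a 1 * ?x)"
      proof -
        have "?q * (a 0 * a 1 * ?x) \<le> 1 * (a 0 * a 1 * ?x)"
          using q a_pos by (intro mult_right_mono mult_nonneg_nonneg) auto
        then show ?thesis by (simp add: algebra_simps)
      qed
      also have "\<dots> \<le> (?q - a 0 * a 1 * ?x)\<^sup>2"
        unfolding power2_diff using zero_le_power2[of "a 0 * a 1 * ?x"] by linarith
      finally show "(norm (of_real (a 0) + of_real (a 1) * cis t))\<^sup>2 \<le> (?q - a 0 * a 1 * ?x)\<^sup>2" .
      have "a 0 * a 1 * ?x \<le> a 0 * a 1 * 2" 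
        using a_pos cos_ge_minus_one[of t] by (intro mult_left_mono) auto
      also have "\<dots> \<le> ?q"
      proof -
        have "a 0 * a 1 \<le> a 0 * 1" "a 0 * a 1 \<le> 1 * a 1"
          using q a_pos by (auto intro!: mult_mono)
        then show ?thesis by simp
      qed
      finally show "0 \<le> ?q - a 0 * a 1 * ?x" by simp
    qed
    also have "?q - a 0 * a 1 * (1 - cos t) + (1 - ?q) \<le> 1 - c * t\<^sup>2"
    proof -
      have "a 0 * a 1 * (t\<^sup>2 / 8) \<le> a 0 * a 1 * (1 - cos t)"
        using cos_le_quadratic[OF t] a_pos by (intro mult_left_mono) auto
      then show ?thesis by (simp add: c_def)
    qed
    also have "\<dots> \<le> exp (- c * t\<^sup>2)" using one_minus_le_exp[of "c * t\<^sup>2"] by simp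
    finally show ?thesis by simp
  qed

  \<comment> \<open>Second-order Taylor expansion under the sum; the linear term vanishes because
    the step is centred (\<open>sum_ka\<close>).\<close>
  have \<psi>_approx: "norm (\<psi> t - of_real (1 - \<sigma> * t\<^sup>2 / 2)) \<le> C * \<bar>t\<bar> ^ 3" for t
  proof -
    let ?x = "\<lambda>k. (real k - 1) * t"
    have "complex_of_real (1 - \<sigma> * t\<^sup>2 / 2) = of_real (\<Sum>k\<le>d. a k) + \<i> * of_real ((\<Sum>k\<le>d. a k * (real k - 1)) * t) - of_real (\<sigma> * t\<^sup>2 / 2)"
      unfolding sum_a sum_ka by simp
    also have "\<dots> = (\<Sum>k\<le>d. of_real (a k) + \<i> * of_real (a k * (real k - 1) * t) - of_real (a k * (real k - 1)\<^sup>2 * (t\<^sup>2 / 2)))"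
      unfolding \<sigma>_def sum_subtractf sum.distrib
      by (simp only: sum_distrib_right[symmetric] sum_distrib_left[symmetric] of_real_sum[symmetric]
            sum_divide_distrib[symmetric] times_divide_eq_right)
    also have "\<dots> = (\<Sum>k\<le>d. of_real (a k) * (1 + \<i> * ?x k - ?x k ^ 2 / 2))"
    proof (rule sum.cong)
      fix k
      have "of_real (a k) + \<i> * of_real (a k * b * t) - of_real (a k * b\<^sup>2 * (t\<^sup>2 / 2)) =
          of_real (a k) * (1 + \<i> * of_real (b * t) - of_real ((b * t)\<^sup>2 / 2))" for b
        by (simp add: algebra_simps power_mult_distrib)
      then show "of_real (a k) + \<i> * of_real (a k * (real k - 1) * t) - of_real (a k * (real k - 1)\<^sup>2 * (t\<^sup>2 / 2)) =
          of_real (a k) * (1 + \<i> * ?x k - ?x k ^ 2 / 2)" .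
    qed simp
    finally have eq: "complex_of_real (1 - \<sigma> * t\<^sup>2 / 2) = (\<Sum>k\<le>d. of_real (a k) * (1 + \<i> * ?x k - ?x k ^ 2 / 2))" .
    have "norm (\<psi> t - of_real (1 - \<sigma> * t\<^sup>2 / 2)) =
        norm (\<Sum>k\<le>d. of_real (a k) * (cis (?x k) - (1 + \<i> * ?x k - ?x k ^ 2 / 2)))"
      by (simp only: eq \<psi>_sum right_diff_distrib sum_subtractf)
    also have "\<dots> \<le> (\<Sum>k\<le>d. norm (of_real (a k) * (cis (?x k) - (1 + \<i> * ?x k - ?x k ^ 2 / 2))))"
      by (rule norm_sum)
    also have "\<dots> \<le> (\<Sum>k\<le>d. a k * (\<bar>?x k\<bar> ^ 3 / 6))"
    proof (rule sum_mono)
      fix k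
      have "norm (cis (?x k) - (1 + \<i> * ?x k - ?x k ^ 2 / 2)) \<le> \<bar>?x k\<bar> ^ 3 / 6"
        by (rule norm_cis_taylor)
      then show "norm (of_real (a k) * (cis (?x k) - (1 + \<i> * ?x k - ?x k ^ 2 / 2))) \<le> a k * (\<bar>?x k\<bar> ^ 3 / 6)"
        unfolding norm_mult norm_of_real abs_of_nonneg[OF a_nonneg]
        by (rule mult_left_mono[OF _ a_nonneg])
    qed
    also have "\<dots> = C * \<bar>t\<bar> ^ 3"
      unfolding C_def sum_distrib_right abs_mult power_mult_distrib by (simp add: mult.assoc)
    finally show ?thesis .
  qed

  \<comment> \<open>With t = s / sqrt n, compare with the n-th power of 1 - \<sigma> t^2 / 2.
    Eventually both bases have modulus at most 1, so the powers differ by at most n C |t|^3 = C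
    |s|^3 / sqrt n.\<close>
  have pointwise: "(\<lambda>n. \<psi> (s / sqrt (real n)) ^ n) \<longlonglongrightarrow> of_real (exp (- (\<sigma> / 2) * s\<^sup>2))" for s
  proof -
    let ?y = "\<lambda>n. 1 + (- (\<sigma> / 2) * s\<^sup>2) / real n"
    have "(\<lambda>n. complex_of_real (?y n ^ n)) \<longlonglongrightarrow> of_real (exp (- (\<sigma> / 2) * s\<^sup>2))"
      by (intro tendsto_of_real tendsto_exp_limit_sequentially)
    moreover have "(\<lambda>n. \<psi> (s / sqrt (real n)) ^ n - complex_of_real (?y n ^ n)) \<longlonglongrightarrow> 0"
    proof (rule Lim_null_comparison)
      show "(\<lambda>n. C * \<bar>s\<bar> ^ 3 / sqrt (real n)) \<longlonglongrightarrow> 0"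
        by real_asymp
      have "(\<lambda>n. \<sigma> / 2 * s\<^sup>2 / real n) \<longlonglongrightarrow> 0" by real_asymp
      then have 1: "\<forall>\<^sub>F n in sequentially. \<sigma> / 2 * s\<^sup>2 / real n < 1" by (rule order_tendstoD) simp
      have "(\<lambda>n. \<bar>s\<bar> / sqrt (real n)) \<longlonglongrightarrow> 0" by real_asymp
      then have 2: "\<forall>\<^sub>F n in sequentially. \<bar>s\<bar> / sqrt (real n) < pi" by (rule order_tendstoD) simp
      from eventually_ge_at_top[of 1] 1 2 show "\<forall>\<^sub>F n in sequentially. norm (\<psi> (s / sqrt (real n)) ^ n - complex_of_real (?y n ^ n)) \<le> C * \<bar>s\<bar> ^ 3 / sqrt (real n)"
      proof eventually_elim
        case (elim n)
        let ?t = "s / sqrt (real n)"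
        have t: "?t\<^sup>2 = s\<^sup>2 / real n" using elim by (simp add: power_divide)
        have y: "?y n = 1 - \<sigma> * ?t\<^sup>2 / 2" using t by simp
        have "0 \<le> \<sigma> / 2 * s\<^sup>2 / real n" using \<sigma>_pos by simp
        then have 1: "norm (complex_of_real (?y n)) \<le> 1"
          unfolding norm_of_real using elim by simp
        have "\<bar>?t\<bar> \<le> pi" using elim by simp
        from \<psi>_bound[OF this] have 2: "norm (\<psi> ?t) \<le> 1"
          using c_pos by (rule_tac order.trans) auto
        have "norm (\<psi> ?t ^ n - complex_of_real (?y n) ^ n) \<le> real n * norm (\<psi> ?t - of_real (?y n))"
          by (rule norm_power_diff[OF 2 1])
        also have "\<dots> \<le> real n * (C * \<bar>?t\<bar> ^ 3)"
          unfolding y by (intro mult_left_mono \<psi>_approx) auto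
        also have "\<dots> = C * \<bar>s\<bar> ^ 3 / sqrt (real n)"
          using elim by (simp add: power_divide power3_eq_cube)
        finally show ?case by simp
      qed
    qed
    ultimately show ?thesis by (rule Lim_transform)
  qed

  have mem: "x \<in> {-pi..pi} \<longleftrightarrow> \<bar>x\<bar> \<le> pi" for x
    by (auto simp: abs_le_iff)
  have [measurable]: "cis \<in> borel_measurable borel"
    unfolding cis_conv_exp[abs_def] by (intro borel_measurable_continuous_onI continuous_intros)
  have [measurable]: "\<psi> \<in> borel_measurable borel"
    unfolding \<psi>_def[abs_def] cis_conv_exp
    by (intro borel_measurable_continuous_onI continuous_intros)
  define I where "I = sqrt (pi / (\<sigma> / 2))"
  have "(\<lambda>n. sqrt (real n) * coeff (p ^ n) (n - m)) \<longlonglongrightarrow> I / (2 * pi)" for m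
  proof -
    \<comment> \<open>The inversion integrand after substituting t = s / sqrt n. At
      \<open>n = 0\<close>, division by zero would make it constantly 1, which the Gaussian does not
      dominate; hence the value 0 there.\<close>
    define g where "g n s = (if n = 0 then 0 else indicator {-pi..pi} (s / sqrt (real n)) *\<^sub>R
        (\<psi> (s / sqrt (real n)) ^ n * cis (real m * (s / sqrt (real n)))))" for n s
    have g_int: "has_bochner_integral lborel (g n) (of_real (sqrt (real n) * (2 * pi * coeff (p ^ n) (n - m))))"
      if n: "n \<ge> m" "n \<ge> 1" for n
    proof -
      \<comment> \<open>The centring turns \<psi>^n into a Fourier integrand of index n, and the
        extra character lowers the index by \<open>m\<close>; \<open>n \<ge> m\<close> makes
        \<open>n - m\<close> a true subtraction.\<close>
      have "\<psi> t ^ n * cis (real m * t) = poly_cis (p ^ n) t * cis (- (real (n - m) * t))" for t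
        using n by (simp add: \<psi>_def power_mult_distrib Complex.DeMoivre poly_cis_power cis_mult of_nat_diff algebra_simps)
      with has_bochner_integral_poly_cis_coeff[of "p ^ n" "n - m"]
      have "has_bochner_integral lborel (\<lambda>t. indicator {-pi..pi} t *\<^sub>R (\<psi> t ^ n * cis (real m * t)))
          (of_real (2 * pi * coeff (p ^ n) (n - m)))" by simp
      then show ?thesis using n unfolding g_def
        by (subst (asm) lborel_has_bochner_integral_real_affine_iff[of "1 / sqrt (real n)" _ _ 0])
           (auto simp: scaleR_conv_of_real field_simps)
    qed
    \<comment> \<open>The quadratic bound is invariant under the scaling: the n-th power of
      \<open>\<psi>_bound\<close> at s / sqrt n is the fixed integrable function
      \<open>exp (- c * s\<^sup>2)\<close>. The factor containing \<open>m\<close> tends to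
      1.\<close>
    have "(\<lambda>n. integral\<^sup>L lborel (g n)) \<longlonglongrightarrow> (\<integral>s. complex_of_real (exp (- (\<sigma> / 2) * s\<^sup>2)) \<partial>lborel)"
    proof (rule integral_dominated_convergence)
      show "integrable lborel (\<lambda>s. exp (- c * s\<^sup>2))"
        using has_bochner_integral_exp_neg_quadratic[OF c_pos] by (simp add: has_bochner_integral_iff)
      show "AE s in lborel. (\<lambda>n. g n s) \<longlonglongrightarrow> complex_of_real (exp (- (\<sigma> / 2) * s\<^sup>2))"
      proof (rule AE_I2)
        fix s
        have "(\<lambda>n. s / sqrt (real n)) \<longlonglongrightarrow> 0" by real_asymp
        then have "(\<lambda>n. cis (real m * (s / sqrt (real n)))) \<longlonglongrightarrow> cis (real m * 0)"
          unfolding cis_conv_exp by (intro tendsto_intros)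
        with pointwise[of s]
        have "(\<lambda>n. \<psi> (s / sqrt (real n)) ^ n * cis (real m * (s / sqrt (real n)))) \<longlonglongrightarrow> of_real (exp (- (\<sigma> / 2) * s\<^sup>2)) * cis (real m * 0)"
          by (rule tendsto_mult)
        moreover have "\<forall>\<^sub>F n in sequentially. \<bar>s / sqrt (real n)\<bar> < pi"
        proof -
          have "(\<lambda>n. s / sqrt (real n)) \<longlonglongrightarrow> 0" by real_asymp
          then have "(\<lambda>n. \<bar>s / sqrt (real n)\<bar>) \<longlonglongrightarrow> 0" by (rule tendsto_rabs_zero)
          then show ?thesis by (rule order_tendstoD) simp
        qed
        then have "\<forall>\<^sub>F n in sequentially. \<psi> (s / sqrt (real n)) ^ n * cis (real m * (s / sqrt (real n))) = g n s"
          using eventually_gt_at_top[of 0]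
        proof eventually_elim
          case (elim n)
          then have "s / sqrt (real n) \<in> {-pi..pi}" by (simp only: mem less_imp_le)
          with elim show ?case by (simp add: g_def indicator_def del: atLeastAtMost_iff)
        qed
        ultimately show "(\<lambda>n. g n s) \<longlonglongrightarrow> complex_of_real (exp (- (\<sigma> / 2) * s\<^sup>2))"
          by (simp add: Lim_transform_eventually)
      qed
      show "AE s in lborel. norm (g n s) \<le> exp (- c * s\<^sup>2)" for n
      proof (rule AE_I2)
        fix s
        show "norm (g n s) \<le> exp (- c * s\<^sup>2)"
        proof (cases "\<bar>s / sqrt (real n)\<bar> \<le> pi \<and> n > 0")
          case True
          have "norm (g n s) \<le> norm (\<psi> (s / sqrt (real n))) ^ n"
            by (simp add: g_def norm_mult norm_power indicator_def)
          also have "\<dots> \<le> exp (- c * (s / sqrt (real n))\<^sup>2) ^ n"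
            using True by (intro power_mono \<psi>_bound) auto
          also have "\<dots> = exp (- c * s\<^sup>2)"
            using True by (simp add: power_divide flip: exp_of_nat_mult)
          finally show ?thesis .
        next
          case False
          then have "n = 0 \<or> s / sqrt (real n) \<notin> {-pi..pi}" by (auto simp only: mem)
          then show ?thesis by (auto simp: g_def indicator_def simp del: atLeastAtMost_iff)
        qed
      qed
      show "g n \<in> borel_measurable lborel" for n
        unfolding g_def by measurable
    qed simp
    also have "(\<integral>s. complex_of_real (exp (- (\<sigma> / 2) * s\<^sup>2)) \<partial>lborel) = of_real I"
      using has_bochner_integral_exp_neg_quadratic[of "\<sigma> / 2"] \<sigma>_pos
      by (simp add: I_def has_bochner_integral_iff)
    finally have "(\<lambda>n. integral\<^sup>L lborel (g n)) \<longlonglongrightarrow> complex_of_real I" .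
    moreover have "\<forall>\<^sub>F n in sequentially. integral\<^sup>L lborel (g n) = complex_of_real (sqrt (real n) * (2 * pi * coeff (p ^ n) (n - m)))"
      using eventually_ge_at_top[of m] eventually_ge_at_top[of 1]
      by eventually_elim (rule has_bochner_integral_integral_eq[OF g_int])
    ultimately have "(\<lambda>n. complex_of_real (sqrt (real n) * (2 * pi * coeff (p ^ n) (n - m)))) \<longlonglongrightarrow> complex_of_real I"
      by (rule Lim_transform_eventually)
    then have "(\<lambda>n. sqrt (real n) * (2 * pi * coeff (p ^ n) (n - m))) \<longlonglongrightarrow> I"
      by (simp only: tendsto_of_real_iff)
    from tendsto_divide[OF this tendsto_const[of "2 * pi"]] show ?thesis by simp
  qed
  moreover have "I / (2 * pi) > 0" using \<sigma>_pos by (simp add: I_def)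
  ultimately show ?thesis using that by blast
qed

section \<open>Ratio limits for forest weights\<close>

text \<open>The polynomial x \<phi>'(x) - \<phi>(x) has coefficients
  \<open>(real k - 1) * w k\<close>, of which only the constant one is negative. The term of degree
  2, present since \<open>D \<ge> 2\<close>, forces a sign change.\<close>

lemma exists_critical_point:
  assumes w: "\<And>k. w k > 0" and D: "D \<ge> 2"
  obtains \<tau> where "\<tau> > 0" "\<tau> * poly (pderiv (offspring_poly D w)) \<tau> = poly (offspring_poly D w) \<tau>"
proof -
  define h where "h x = (\<Sum>k\<le>D. (real k - 1) * w k * x ^ k)" for x
  \<comment> \<open>At this point the terms of degree 0 and 2 cancel, and all others are
    nonnegative.\<close>
  define b where "b = sqrt (w 0 / w 2)"
  have b: "b \<ge> 0" "b\<^sup>2 = w 0 / w 2" using w[of 0] w[of 2] by (simp_all add: b_def)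
  have h0: "h 0 = - w 0"
  proof -
    have "h 0 = (\<Sum>k\<le>D. if k = 0 then - w 0 else 0)"
      unfolding h_def by (rule sum.cong) auto
    then show ?thesis by simp
  qed
  have "0 = (\<Sum>k\<in>{0, 2}. (real k - 1) * w k * b ^ k)"
    using w[of 2] by (simp add: b)
  also have "\<dots> \<le> h b"
    unfolding h_def
  proof (rule sum_mono2)
    fix k assume "k \<in> {..D} - {0, 2}"
    then show "0 \<le> (real k - 1) * w k * b ^ k"
      using w[of k] b(1) by (cases "k = 0") auto
  qed (use D in auto)
  finally have hb: "0 \<le> h b" .
  have "continuous_on {0..b} h"
    unfolding h_def[abs_def] by (intro continuous_intros)
  then obtain \<tau> where \<tau>: "0 \<le> \<tau>" "h \<tau> = 0"
    using IVT'[of h 0 0 b] b(1) w[of 0] h0 hb by force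
  have "\<tau> > 0" using \<tau> h0 w[of 0] by (cases "\<tau> = 0") auto
  moreover have "\<tau> * poly (pderiv (offspring_poly D w)) \<tau> - poly (offspring_poly D w) \<tau> = h \<tau>"
  proof -
    have "\<tau> * (real k * w k * \<tau> ^ (k - 1)) = real k * w k * \<tau> ^ k" for k
      by (cases k) auto
    moreover have "poly (pderiv (offspring_poly D w)) \<tau> = (\<Sum>k\<le>D. real k * w k * \<tau> ^ (k - 1))"
      by (simp add: offspring_poly_def higher_pderiv_sum[of 1, simplified] pderiv_monom poly_sum poly_monom)
    ultimately have "\<tau> * poly (pderiv (offspring_poly D w)) \<tau> = (\<Sum>k\<le>D. real k * w k * \<tau> ^ k)"
      by (simp only: sum_distrib_left)
    then show ?thesis
      by (simp add: offspring_poly_def poly_sum poly_monom h_def algebra_simps sum_subtractf)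
  qed
  ultimately show ?thesis using \<tau>(2) that by simp
qed

lemma pcompose_power: "pcompose (p ^ n) q = pcompose p q ^ n"
  for p :: "'a :: comm_semiring_1 poly"
  by (induction n) (simp_all add: pcompose_mult pcompose_1)

text \<open>Lagrange's formula accounts for the factor \<open>real N\<close>, the local limit
  theorem for the tilted polynomial for \<open>sqrt (real N)\<close>. Undoing the tilt leaves
  \<open>r ^ N\<close> and \<open>\<tau> ^ m\<close>.\<close>

lemma forest_sum_asymptotics:
  assumes w: "\<And>k. w k > 0" and D: "D \<ge> 2"
  shows "\<exists>r \<tau> L. r > 0 \<and> \<tau> > 0 \<and> L > 0 \<and>
    (\<forall>m. (\<lambda>N. r ^ N * (real N * sqrt (real N)) * forest_sum D w N m) \<longlonglongrightarrow> real m * \<tau> ^ m * L)"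
proof -
  let ?\<phi> = "offspring_poly D w"
  obtain \<tau> where \<tau>: "\<tau> > 0" "\<tau> * poly (pderiv ?\<phi>) \<tau> = poly ?\<phi> \<tau>"
    using exists_critical_point[of w D] w D by blast
  have \<phi>_pos: "poly ?\<phi> \<tau> > 0"
    using \<tau>(1) w by (auto simp: offspring_poly_def poly_sum poly_monom intro!: sum_pos)
  \<comment> \<open>The derivative of \<open>p\<close> at 1 is \<tau> \<phi>'(\<tau>) /
    \<phi>(\<tau>), which the choice of \<tau> makes equal to 1.\<close>
  define p where "p = smult (1 / poly ?\<phi> \<tau>) (pcompose ?\<phi> [:0, \<tau>:])"
  have p_power: "coeff (p ^ n) k = coeff (?\<phi> ^ n) k * \<tau> ^ k / poly ?\<phi> \<tau> ^ n" for n k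
    by (simp add: p_def smult_power coeff_pcompose_linear power_divide flip: pcompose_power)
  have p_coeff: "coeff p k = coeff ?\<phi> k * \<tau> ^ k / poly ?\<phi> \<tau>" for k
    using p_power[of 1 k] by simp
  obtain L where L: "L > 0" "\<And>m. (\<lambda>n. sqrt (real n) * coeff (p ^ n) (n - m)) \<longlonglongrightarrow> L"
  proof (rule local_limit[of p])
    show "coeff p k \<ge> 0" for k
      using w[of k] \<tau>(1) \<phi>_pos by (simp add: p_coeff coeff_offspring_poly)
    show "coeff p 0 > 0" "coeff p 1 > 0"
      using w \<tau>(1) \<phi>_pos D by (simp_all add: p_coeff coeff_offspring_poly)
    show "poly p 1 = 1" using \<phi>_pos by (simp add: p_def poly_pcompose)
    show "poly (pderiv p) 1 = 1"
      using \<phi>_pos \<tau> by (simp add: p_def pderiv_smult pderiv_pcompose poly_pcompose pderiv_pCons mult.commute)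
  qed blast
  define r where "r = \<tau> / poly ?\<phi> \<tau>"
  have r: "r > 0" using \<tau> \<phi>_pos by (simp add: r_def)
  have "(\<lambda>N. r ^ N * (real N * sqrt (real N)) * forest_sum D w N m) \<longlonglongrightarrow> real m * \<tau> ^ m * L" for m
  proof (rule Lim_transform_eventually)
    show "(\<lambda>N. real m * \<tau> ^ m * (sqrt (real N) * coeff (p ^ N) (N - m))) \<longlonglongrightarrow> real m * \<tau> ^ m * L"
      by (intro tendsto_intros L)
    show "\<forall>\<^sub>F N in sequentially. real m * \<tau> ^ m * (sqrt (real N) * coeff (p ^ N) (N - m)) =
        r ^ N * (real N * sqrt (real N)) * forest_sum D w N m"
      using eventually_ge_at_top[of m]
    proof eventually_elim
      case (elim N)
      have "r ^ N * (real N * sqrt (real N)) * forest_sum D w N m =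
          r ^ N * sqrt (real N) * (real N * forest_sum D w N m)" by simp
      also have "\<dots> = r ^ N * sqrt (real N) * (real m * coeff (?\<phi> ^ N) (N - m))"
        using elim by (simp only: forest_sum_lagrange) (simp add: coeff_monom_mult)
      also have "\<dots> = real m * \<tau> ^ m * (sqrt (real N) * coeff (p ^ N) (N - m))"
      proof -
        have "\<tau> ^ N = \<tau> ^ m * \<tau> ^ (N - m)" using elim by (simp flip: power_add)
        then show ?thesis by (simp add: p_power r_def power_divide)
      qed
      finally show ?case by (rule sym)
    qed
  qed
  with r \<tau>(1) L(1) show ?thesis by blast
qed

text \<open>For \<open>D = 1\<close> the only tree of a given size is the path: one leaf, all other
  vertices of degree 1. With positive weights a linear \<phi> has no critical point, so this case is
  handled by the explicit formula.\<close>

lemma forest_sum_unary: "forest_sum 1 w (Suc N) 1 = w 0 * w 1 ^ N"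
proof (induction N)
  case 0
  then show ?case using forest_sum_Suc[of 1 w 0 0] by (simp add: forest_sum_0 forest_sum_eq_0)
next
  case (Suc N)
  then show ?case using forest_sum_Suc[of 1 w "Suc N" 0] by (simp add: forest_sum_0)
qed

text \<open>For \<open>D = 1\<close> a forest of \<open>m\<close> paths can be cut in about \<open>N\<^sup>m\<^sup>-\<^sup>1\<close> ways, so the ratio diverges for \<open>m \<ge> 2\<close>.\<close>

lemma convergent_forest_sum_ratio:
  assumes w: "\<And>k. w k > 0" and D: "D \<ge> 1" and m: "D = 1 \<Longrightarrow> m \<le> 1"
  shows "convergent (\<lambda>N. forest_sum D w (N - j) m / forest_sum D w N 1)"
proof -
  \<comment> \<open>Shifting \<open>N\<close> by \<open>j\<close> avoids truncated subtraction;
    \<open>LIMSEQ_offset\<close> shifts back.\<close>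
  have "\<exists>l. (\<lambda>N. forest_sum D w N m / forest_sum D w (N + j) 1) \<longlonglongrightarrow> l"
  proof (cases "D = 1")
    case True
    have "(\<lambda>N. forest_sum D w (Suc N) m / forest_sum D w (Suc N + j) 1) = (\<lambda>N. if m = 0 then 0 else 1 / w 1 ^ j)"
    proof
      fix N
      have "w 0 \<noteq> 0" "w 1 \<noteq> 0" using w[of 0] w[of 1] by simp_all
      moreover have "m = 0 \<or> m = 1" using m[OF True] by linarith
      ultimately show "forest_sum D w (Suc N) m / forest_sum D w (Suc N + j) 1 = (if m = 0 then 0 else 1 / w 1 ^ j)"
        unfolding True add_Suc forest_sum_unary by (auto simp: forest_sum_0 forest_sum_unary[simplified] power_add)
    qed
    then have "(\<lambda>N. forest_sum D w (Suc N) m / forest_sum D w (Suc N + j) 1) \<longlonglongrightarrow> (if m = 0 then 0 else 1 / w 1 ^ j)"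
      by (simp only: tendsto_const)
    then have "(\<lambda>N. forest_sum D w N m / forest_sum D w (N + j) 1) \<longlonglongrightarrow> (if m = 0 then 0 else 1 / w 1 ^ j)"
      by (rule LIMSEQ_imp_Suc)
    then show ?thesis by (rule exI)
  next
    case False
    with D have "D \<ge> 2" by simp
    from forest_sum_asymptotics[of w D, OF w this] obtain r \<tau> L
      where r: "r > 0" "\<tau> > 0" "L > 0"
        and lim: "\<forall>m. (\<lambda>N. r ^ N * (real N * sqrt (real N)) * forest_sum D w N m) \<longlonglongrightarrow> real m * \<tau> ^ m * L"
      by (elim exE conjE)
    define G where "G m N = r ^ N * (real N * sqrt (real N)) * forest_sum D w N m" for m N
    have "(\<lambda>N. (real (N + j) * sqrt (real (N + j))) / (real N * sqrt (real N))) \<longlonglongrightarrow> 1"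
      by real_asymp
    moreover have "G m \<longlonglongrightarrow> real m * \<tau> ^ m * L"
      unfolding G_def[abs_def] by (rule lim[rule_format])
    moreover have "(\<lambda>N. G 1 (N + j)) \<longlonglongrightarrow> real 1 * \<tau> ^ 1 * L"
      by (rule LIMSEQ_ignore_initial_segment) (unfold G_def[abs_def], rule lim[rule_format])
    \<comment> \<open>The normalisations at sizes \<open>N\<close> and \<open>N + j\<close> differ
      by \<open>r ^ j\<close> and a ratio tending to 1; the denominator has the positive limit
      \<tau> L.\<close>
    ultimately have "(\<lambda>N. G m N / G 1 (N + j) * (r ^ j * ((real (N + j) * sqrt (real (N + j))) / (real N * sqrt (real N)))))
        \<longlonglongrightarrow> (real m * \<tau> ^ m * L) / (real 1 * \<tau> ^ 1 * L) * (r ^ j * 1)"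
      using r by (intro tendsto_mult tendsto_divide tendsto_const) auto
    moreover have "\<forall>\<^sub>F N in sequentially. G m N / G 1 (N + j) * (r ^ j * ((real (N + j) * sqrt (real (N + j))) / (real N * sqrt (real N)))) =
        forest_sum D w N m / forest_sum D w (N + j) 1"
      using eventually_gt_at_top[of 0]
      by eventually_elim (use r in \<open>simp add: G_def power_add\<close>)
    ultimately show ?thesis by (intro exI) (rule Lim_transform_eventually)
  qed
  then obtain l where l: "(\<lambda>N. forest_sum D w N m / forest_sum D w (N + j) 1) \<longlonglongrightarrow> l" ..
  have "(\<lambda>N. forest_sum D w (N - j) m / forest_sum D w N 1) \<longlonglongrightarrow> l"
    by (rule LIMSEQ_offset[of _ j]) (simp only: add_diff_cancel_right' l)
  then show ?thesis by (auto simp: convergent_def)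
qed

section \<open>Fibres of the truncation\<close>

lemma split_list_lengths:
  "length xs = sum_list ns \<Longrightarrow> \<exists>xss. concat xss = xs \<and> map length xss = ns"
proof (induction ns arbitrary: xs)
  case (Cons n ns)
  then have "length (drop n xs) = sum_list ns" by simp
  with Cons.IH obtain xss where "concat xss = drop n xs" "map length xss = ns" by blast
  with Cons.prems show ?case
    by (intro exI[of _ "take n xs # xss"]) auto
qed simp

lemma children_truncate_tree: "children (truncate_tree (Suc n) T) = map (truncate_tree n) (children T)"
  by (cases T) simp

text \<open>Concatenating the child lists forgets which root each tree hangs from; the list of
  degrees keeps exactly this information. One level can thus be peeled off a whole forest at
  once.\<close>

lemma map_truncate_tree_Suc_iff:
  "map (truncate_tree (Suc n)) ts = ss \<longleftrightarrow>
     map (\<lambda>t. length (children t)) ts = map (\<lambda>t. length (children t)) ss \<and>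
     map (truncate_tree n) (concat (map children ts)) = concat (map children ss)"
proof (induction ts arbitrary: ss)
  case (Cons t ts)
  show ?case
  proof (cases ss)
    case (Cons s us)
    have 1: "truncate_tree (Suc n) t = s \<longleftrightarrow> map (truncate_tree n) (children t) = children s"
      by (cases t; cases s) auto
    have 2: "map (truncate_tree n) (children t) @ xs = children s @ ys \<longleftrightarrow>
        map (truncate_tree n) (children t) = children s \<and> xs = ys"
      if "length (children t) = length (children s)" for xs ys
      using that by (intro append_eq_append_conv) simp
    have 3: "length (children t) = length (children s)"
      if "map (truncate_tree n) (children t) = children s"
      using that by (metis length_map)
    show ?thesis
      unfolding Cons list.map concat.simps map_append list.inject 1 Cons.IH[of us]
      using 2 3 by blast
  qed simp
qed auto

lemma sum_vcount_children:
  "(\<Sum>t\<leftarrow>ts. vcount t) = length ts + (\<Sum>t\<leftarrow>concat (map children ts). vcount t)"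
proof (induction ts)
  case (Cons t ts)
  then show ?case by (cases t) simp
qed simp

lemma deg_le_children:
  "(\<forall>t\<in>set ts. deg_le D t) \<longleftrightarrow>
     (\<forall>t\<in>set ts. length (children t) \<le> D) \<and> (\<forall>t\<in>set (concat (map children ts)). deg_le D t)"
proof (induction ts)
  case (Cons t ts)
  then show ?case by (cases t) auto
qed simp

lemma prod_weight_children:
  "(\<Prod>t\<leftarrow>ts. weight w t) =
     (\<Prod>k\<leftarrow>map (\<lambda>t. length (children t)) ts. w k) * (\<Prod>t\<leftarrow>concat (map children ts). weight w t)"
proof (induction ts)
  case (Cons t ts)
  then show ?case by (cases t) simp
qed simp

text \<open>Stated for forests because removing the root of a tree leaves a forest; the induction on
  \<open>n\<close> then stays within one class.\<close>

definition truncation_fibre :: "nat \<Rightarrow> nat \<Rightarrow> plane_tree list \<Rightarrow> nat \<Rightarrow> plane_tree list set" where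
  "truncation_fibre D n ss N = {ts \<in> forests D N (length ss). map (truncate_tree n) ts = ss}"

text \<open>The degrees of the roots are prescribed by \<open>ss\<close>, so the roots contribute a
  constant factor, and removing them is a bijection onto the fibre one level lower.\<close>

lemma sum_truncation_fibre_Suc:
  fixes w :: "nat \<Rightarrow> real"
  assumes "\<forall>s\<in>set ss. length (children s) \<le> D" and "length ss \<le> N"
  shows "(\<Sum>ts\<in>truncation_fibre D (Suc n) ss N. \<Prod>t\<leftarrow>ts. weight w t) =
    (\<Prod>s\<leftarrow>ss. w (length (children s))) *
    (\<Sum>ts\<in>truncation_fibre D n (concat (map children ss)) (N - length ss). \<Prod>t\<leftarrow>ts. weight w t)"
proof -
  let ?\<Psi> = "\<lambda>ts. concat (map children ts)"
  let ?len = "\<lambda>t. length (children t)"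
  let ?A = "truncation_fibre D (Suc n) ss N"
  let ?B = "truncation_fibre D n (concat (map children ss)) (N - length ss)"
  \<comment> \<open>Used in both directions: to see that \<open>?\<Psi>\<close> maps into
    \<open>?B\<close> and to verify preimages.\<close>
  have A: "ts \<in> ?A \<longleftrightarrow> map ?len ts = map ?len ss \<and> ?\<Psi> ts \<in> ?B" for ts
  proof (cases "map ?len ts = map ?len ss \<and> map (truncate_tree n) (?\<Psi> ts) = ?\<Psi> ss")
    case True
    then have l: "length ts = length ss" by (metis length_map)
    have "\<forall>k\<in>set (map ?len ss). k \<le> D" using assms(1) by simp
    then have "\<forall>k\<in>set (map ?len ts). k \<le> D" using True by metis
    then have deg: "\<forall>t\<in>set ts. ?len t \<le> D" by simp
    have "length (?\<Psi> ts) = length (?\<Psi> ss)" using True by (metis length_map)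
    moreover have "map (truncate_tree (Suc n)) ts = ss" using True map_truncate_tree_Suc_iff by blast
    moreover have "(\<Sum>t\<leftarrow>ts. vcount t) = N \<longleftrightarrow> (\<Sum>t\<leftarrow>?\<Psi> ts. vcount t) = N - length ss"
      using assms(2) l sum_vcount_children[of ts] by linarith
    ultimately show ?thesis
      using True l deg deg_le_children[of ts D]
      unfolding truncation_fibre_def forests_def by blast
  next
    case False
    then show ?thesis unfolding truncation_fibre_def map_truncate_tree_Suc_iff by blast
  qed
  \<comment> \<open>Equal degree lists cut the concatenation at the same places.\<close>
  have "inj_on ?\<Psi> ?A"
  proof (rule inj_onI)
    fix ts us assume "ts \<in> ?A" "us \<in> ?A" and eq: "?\<Psi> ts = ?\<Psi> us"
    then have len: "map ?len ts = map ?len us" by (simp add: A)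
    then have l: "length ts = length us" by (rule map_eq_imp_length_eq)
    have "map children ts = map children us"
    proof (rule concat_injective)
      show "\<forall>(x, y)\<in>set (zip (map children ts) (map children us)). length x = length y"
        using len l by (auto simp: set_zip list_eq_iff_nth_eq)
    qed (use eq l in auto)
    moreover have "inj (map children)"
      by (intro inj_mapI injI plane_tree.expand)
    ultimately show "ts = us" by (simp only: inj_eq)
  qed
  moreover have "?\<Psi> ` ?A = ?B"
  proof (intro equalityI subsetI)
    fix us assume us: "us \<in> ?B"
    then have "length us = sum_list (map ?len ss)"
      by (simp add: truncation_fibre_def forests_def length_concat comp_def)
    \<comment> \<open>Cut \<open>us\<close> into blocks of the prescribed lengths; a root over each
      block gives the preimage.\<close>
    then obtain uss where uss: "concat uss = us" "map length uss = map ?len ss"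
      using split_list_lengths by blast
    then have "us = ?\<Psi> (map Node uss)" "map ?len (map Node uss) = map ?len ss"
      by (simp_all add: comp_def)
    with us have "map Node uss \<in> ?A" by (simp only: A simp_thms)
    with \<open>us = ?\<Psi> (map Node uss)\<close> show "us \<in> ?\<Psi> ` ?A" by (rule image_eqI)
  qed (auto simp: A)
  ultimately have "(\<Sum>ts\<in>?B. \<Prod>t\<leftarrow>ts. weight w t) = (\<Sum>ts\<in>?A. \<Prod>t\<leftarrow>?\<Psi> ts. weight w t)"
    by (intro sum.reindex_cong[of ?\<Psi>]) auto
  moreover have "(\<Prod>t\<leftarrow>ts. weight w t) = (\<Prod>s\<leftarrow>ss. w (?len s)) * (\<Prod>t\<leftarrow>?\<Psi> ts. weight w t)"
    if "ts \<in> ?A" for ts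
  proof -
    have "map ?len ts = map ?len ss" using that unfolding A by blast
    then show ?thesis unfolding prod_weight_children[of w ts] by (simp add: comp_def)
  qed
  ultimately show ?thesis by (simp add: sum_distrib_left)
qed

text \<open>In the construction \<open>j\<close> counts the vertices of \<open>ss\<close> of height
  below \<open>n\<close>, \<open>c\<close> is the product of their weights, and \<open>m\<close>
  counts the vertices at height \<open>n\<close>, where the remaining trees are grafted freely. For
  \<open>D = 1\<close> levels cannot grow, which bounds \<open>m\<close>.\<close>

lemma sum_truncation_fibre:
  fixes w :: "nat \<Rightarrow> real"
  assumes "\<forall>s\<in>set ss. deg_le D s \<and> truncate_tree n s = s"
  shows "\<exists>c j m. (D = 1 \<longrightarrow> m \<le> length ss) \<and>
    (\<forall>N\<ge>j. (\<Sum>ts\<in>truncation_fibre D n ss N. \<Prod>t\<leftarrow>ts. weight w t) = c * forest_sum D w (N - j) m)"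
  using assms
proof (induction n arbitrary: ss)
  case 0
  \<comment> \<open>Level 0 truncation forgets everything and \<open>ss\<close> consists of single
    vertices, so the condition on the truncation is automatic.\<close>
  have "truncation_fibre D 0 ss N = forests D N (length ss)" for N
  proof -
    have "ss = replicate (length ss) (Node [])"
      using 0 by (intro replicate_eqI) auto
    then have "map (truncate_tree 0) ts = ss" if "length ts = length ss" for ts
      using that by (metis map_eq_conv map_replicate_const truncate_tree.simps(1))
    then show ?thesis
      unfolding truncation_fibre_def forests_def by blast
  qed
  then show ?case
    by (intro exI[of _ 1] exI[of _ 0] exI[of _ "length ss"]) (simp add: forest_sum_def)
next
  case (Suc n)
  let ?us = "concat (map children ss)"
  have deg: "(\<forall>s\<in>set ss. length (children s) \<le> D) \<and> (\<forall>u\<in>set ?us. deg_le D u)"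
    using Suc.prems deg_le_children[of ss D] by blast
  have "truncate_tree n u = u" if "u \<in> set ?us" for u
  proof -
    from that obtain s where s: "s \<in> set ss" "u \<in> set (children s)" by auto
    then have "map (truncate_tree n) (children s) = children s"
      using Suc.prems by (metis children_truncate_tree)
    then show ?thesis using s(2) by (metis map_idI in_set_conv_nth nth_map)
  qed
  with Suc.IH[of ?us] deg obtain c j m where m: "D = 1 \<longrightarrow> m \<le> length ?us"
    and IH: "\<And>N. N \<ge> j \<Longrightarrow> (\<Sum>ts\<in>truncation_fibre D n ?us N. \<Prod>t\<leftarrow>ts. weight w t) = c * forest_sum D w (N - j) m"
    by blast
  have "length ?us \<le> D * length ss"
    using deg by (induction ss) auto
  with m have "D = 1 \<longrightarrow> m \<le> length ss" by auto
  moreover have "(\<Sum>ts\<in>truncation_fibre D (Suc n) ss N. \<Prod>t\<leftarrow>ts. weight w t) =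
      ((\<Prod>s\<leftarrow>ss. w (length (children s))) * c) * forest_sum D w (N - (length ss + j)) m"
    if "N \<ge> length ss + j" for N
    using that deg by (simp add: sum_truncation_fibre_Suc IH diff_diff_left)
  ultimately show ?case by blast
qed

section \<open>Convergence in total variation\<close>

text \<open>The absolute value suits the comparison with a null sequence. The lower bound comes from
  the empty set, once the uniform bound shows that the supremum is over a bounded family.\<close>

lemma total_variation_le_sum:
  fixes M P :: "'a measure"
  assumes S: "finite S" and sets: "sets M = Pow S"
    and M: "\<And>B. B \<subseteq> S \<Longrightarrow> measure M B = (\<Sum>s\<in>B. f s)"
    and P: "\<And>B. B \<subseteq> S \<Longrightarrow> measure P B = (\<Sum>s\<in>B. g s)"
  shows "\<bar>total_variation M P\<bar> \<le> (\<Sum>s\<in>S. \<bar>f s - g s\<bar>)"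
proof -
  have *: "\<bar>measure M B - measure P B\<bar> \<le> (\<Sum>s\<in>S. \<bar>f s - g s\<bar>)" if B: "B \<in> Pow S" for B
  proof -
    have "\<bar>measure M B - measure P B\<bar> = \<bar>\<Sum>s\<in>B. f s - g s\<bar>"
      using B by (simp add: M P sum_subtractf)
    also have "\<dots> \<le> (\<Sum>s\<in>B. \<bar>f s - g s\<bar>)" by (rule sum_abs)
    also have "\<dots> \<le> (\<Sum>s\<in>S. \<bar>f s - g s\<bar>)"
      using B S by (intro sum_mono2) auto
    finally show ?thesis .
  qed
  have "total_variation M P \<le> (\<Sum>s\<in>S. \<bar>f s - g s\<bar>)"
    unfolding total_variation_def sets by (rule cSUP_least) (use * in auto)
  moreover have "0 \<le> total_variation M P"
  proof -
    have "\<bar>measure M {} - measure P {}\<bar> \<le> total_variation M P"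
      unfolding total_variation_def sets
      by (rule cSUP_upper) (auto intro!: bdd_aboveI2 *)
    then show ?thesis by simp
  qed
  ultimately show ?thesis by simp
qed

section \<open>Single trees as one-element forests, and the limit measure\<close>

lemma forests_one: "forests D N 1 = (\<lambda>T. [T]) ` trees D N"
  by (auto simp: forests_def trees_eq length_Suc_conv)

lemma finite_trees: "finite (trees D N)"
proof -
  have "inj (\<lambda>T. [T])" by (rule injI) simp
  then show ?thesis
    using finite_forests[of D N 1] unfolding forests_one by (metis finite_imageD inj_on_subset subset_UNIV)
qed

text \<open>A trivial \<open>Q\<close> gives the partition function, a condition on the truncation
  gives the weight of a fibre.\<close>

lemma sum_trees: "(\<Sum>T\<in>{T \<in> trees D N. Q [T]}. weight w T) = (\<Sum>ts\<in>{ts \<in> forests D N 1. Q ts}. \<Prod>t\<leftarrow>ts. weight w t)"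
proof -
  have "{ts \<in> forests D N 1. Q ts} = (\<lambda>T. [T]) ` {T \<in> trees D N. Q [T]}"
    unfolding forests_one by auto
  then show ?thesis by (simp add: sum.reindex inj_on_def)
qed

text \<open>The path is a witness; this makes the partition function positive.\<close>

lemma trees_nonempty:
  assumes "D \<ge> 1"
  shows "trees D (Suc N) \<noteq> {}"
proof (induction N)
  case 0
  have "Node [] \<in> trees D (Suc 0)" by (simp add: trees_eq)
  then show ?case by blast
next
  case (Suc N)
  then obtain T where "T \<in> trees D (Suc N)" by blast
  with assms have "Node [T] \<in> trees D (Suc (Suc N))" by (simp add: trees_eq)
  then show ?case by blast
qed

theorem theorem1:
  fixes D :: nat and E :: "nat \<Rightarrow> real" and \<beta> :: real
  assumes "D \<ge> 1"
  shows "\<forall>n\<ge>1.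
    (\<forall>\<^sub>F N in sequentially. prob_space (gibbs_measure D E \<beta> N) \<and>
        truncate_tree n \<in> measurable (gibbs_measure D E \<beta> N) (count_space (trees_of_height D n))) \<and>
    (\<exists>P. prob_space P \<and> sets P = sets (count_space (trees_of_height D n)) \<and>
        (\<lambda>N. total_variation
               (distr (gibbs_measure D E \<beta> N) (count_space (trees_of_height D n)) (truncate_tree n)) P)
          \<longlonglongrightarrow> 0)"
proof (intro allI impI)
  fix n :: nat
  define w where "w k = exp (- \<beta> * E k)" for k
  define S where "S = trees_of_height D n"
  define Z where "Z N = forest_sum D w N 1" for N
  \<comment> \<open>The mass of \<open>s\<close> under the push-forward, defined for every
    \<open>N\<close> so that limits make sense before the truncation is known to land in
    \<open>S\<close>.\<close>
  define q where "q N s = (\<Sum>T\<in>{T \<in> trees D N. truncate_tree n T = s}. weight w T) / Z N" for N s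
  let ?\<mu> = "gibbs_measure D E \<beta>"
  let ?\<nu> = "\<lambda>N. distr (?\<mu> N) (count_space S) (truncate_tree n)"
  have w: "w k > 0" for k by (simp add: w_def)
  have finS: "finite S" by (simp add: S_def finite_trees_of_height)
  have Z_eq: "Z N = (\<Sum>T\<in>trees D N. weight w T)" for N
    using sum_trees[of w D N "\<lambda>_. True"] by (simp add: Z_def forest_sum_def)
  have \<mu>_eq: "?\<mu> N = point_measure (trees D N) (\<lambda>T. ennreal (weight w T / Z N))" for N
    unfolding gibbs_measure_def partition_function_def exp_energy Z_eq w_def ..
  have q_nonneg: "q N s \<ge> 0" for N s
    unfolding q_def Z_eq by (intro divide_nonneg_nonneg sum_nonneg less_imp_le[OF weight_pos[OF w]])

  have good: "\<forall>\<^sub>F N in sequentially. N \<ge> 1 \<and> truncate_tree n ` trees D N \<subseteq> S"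
    using eventually_ge_at_top[of 1] eventually_truncate_tree_in[of D n]
    unfolding S_def image_subset_iff by (rule eventually_conj)
  have Z_pos: "Z N > 0" if "N \<ge> 1" for N
  proof -
    from that obtain K where "N = Suc K" by (cases N) auto
    then show ?thesis
      unfolding Z_eq using trees_nonempty[OF assms, of K]
      by (intro sum_pos finite_trees weight_pos w) auto
  qed
  have prob: "prob_space (?\<mu> N)" if "N \<ge> 1" for N
    unfolding \<mu>_eq
  proof (rule prob_space_point_measure)
    show "(\<Sum>T\<in>trees D N. ennreal (weight w T / Z N)) = 1"
    proof -
      have "(\<Sum>T\<in>trees D N. weight w T / Z N) = 1"
        using Z_pos[OF that] by (simp add: Z_eq flip: sum_divide_distrib)
      then show ?thesis
        using Z_pos[OF that] weight_pos[of w, OF w] by (subst sum_ennreal) (auto intro!: divide_nonneg_nonneg less_imp_le)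
    qed
  qed (simp_all add: finite_trees)
  have meas: "truncate_tree n \<in> measurable (?\<mu> N) (count_space S)"
    if "truncate_tree n ` trees D N \<subseteq> S" for N
    using that by (auto simp: \<mu>_eq)
  have \<nu>_measure: "measure (?\<nu> N) B = (\<Sum>s\<in>B. q N s)"
    if N: "N \<ge> 1" "truncate_tree n ` trees D N \<subseteq> S" and B: "B \<subseteq> S" for N B
  proof -
    let ?A = "{T \<in> trees D N. truncate_tree n T \<in> B}"
    have "measure (?\<nu> N) B = measure (?\<mu> N) (truncate_tree n -` B \<inter> space (?\<mu> N))"
      using B by (intro measure_distr meas N) auto
    also have "truncate_tree n -` B \<inter> space (?\<mu> N) = ?A"
      by (auto simp: \<mu>_eq space_point_measure)
    also have "measure (?\<mu> N) ?A = (\<Sum>T\<in>?A. weight w T / Z N)"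
      unfolding \<mu>_eq using Z_pos[OF N(1)] weight_pos[of w, OF w]
      by (subst measure_point_measure_finite_if) (auto simp: finite_trees intro!: divide_nonneg_nonneg less_imp_le)
    also have "\<dots> = (\<Sum>s\<in>B. \<Sum>T\<in>{T \<in> ?A. truncate_tree n T = s}. weight w T / Z N)"
      using B finS by (intro sum.group[symmetric]) (auto simp: finite_trees intro: finite_subset)
    also have "\<dots> = (\<Sum>s\<in>B. q N s)"
      unfolding q_def sum_divide_distrib by (intro sum.cong) auto
    finally show ?thesis .
  qed

  \<comment> \<open>The fibre over \<open>s\<close> is that of the forest \<open>[s]\<close>, so for
    \<open>D = 1\<close> the bound on \<open>m\<close> is 1, as the ratio limit requires.\<close>
  have "convergent (\<lambda>N. q N s)" if s: "s \<in> S" for s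
  proof -
    have ds: "\<forall>t\<in>set [s]. deg_le D t \<and> truncate_tree n t = t"
      using s by (simp add: S_def trees_of_height_def deg_le_iff truncate_tree_id)
    then obtain c j m where m: "D = 1 \<longrightarrow> m \<le> length [s]"
      and cj: "\<forall>N\<ge>j. (\<Sum>ts\<in>truncation_fibre D n [s] N. \<Prod>t\<leftarrow>ts. weight w t) = c * forest_sum D w (N - j) m"
      using sum_truncation_fibre[of "[s]" D n w] by blast
    have "q N s = c * (forest_sum D w (N - j) m / forest_sum D w N 1)" if "N \<ge> j" for N
    proof -
      have "(\<Sum>T\<in>{T \<in> trees D N. truncate_tree n T = s}. weight w T) =
          (\<Sum>ts\<in>truncation_fibre D n [s] N. \<Prod>t\<leftarrow>ts. weight w t)"
        using sum_trees[of w D N "\<lambda>ts. map (truncate_tree n) ts = [s]"]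
        by (simp add: truncation_fibre_def)
      with cj that show ?thesis by (simp add: q_def Z_def)
    qed
    moreover have "convergent (\<lambda>N. c * (forest_sum D w (N - j) m / forest_sum D w N 1))"
      using convergent_forest_sum_ratio[of w D m j, OF w assms] m
      by (intro convergent_mult convergent_const) simp
    ultimately show ?thesis
      by (subst convergent_cong[of _ "\<lambda>N. c * (forest_sum D w (N - j) m / forest_sum D w N 1)"])
         (auto intro: eventually_sequentiallyI[of j])
  qed
  then have "\<forall>s\<in>S. \<exists>l. (\<lambda>N. q N s) \<longlonglongrightarrow> l" by (simp add: convergent_def)
  then obtain l where l: "\<And>s. s \<in> S \<Longrightarrow> (\<lambda>N. q N s) \<longlonglongrightarrow> l s" by metis
  have l_nonneg: "l s \<ge> 0" if "s \<in> S" for s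
    using l[OF that] by (rule LIMSEQ_le_const) (simp add: q_nonneg)
  \<comment> \<open>A finite sum commutes with the limit, so the limiting masses again sum to
    1.\<close>
  have "\<forall>\<^sub>F N in sequentially. (\<Sum>s\<in>S. q N s) = 1"
    using good
  proof eventually_elim
    case (elim N)
    then interpret prob_space "?\<nu> N"
      using prob meas by (intro prob_space.prob_space_distr) auto
    show ?case using \<nu>_measure[of N S] elim prob_space by simp
  qed
  then have "(\<lambda>N. \<Sum>s\<in>S. q N s) \<longlonglongrightarrow> 1" by (rule tendsto_eventually)
  moreover have "(\<lambda>N. \<Sum>s\<in>S. q N s) \<longlonglongrightarrow> (\<Sum>s\<in>S. l s)"
    by (intro tendsto_sum l)
  ultimately have sum_l: "(\<Sum>s\<in>S. l s) = 1" using LIMSEQ_unique by blast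
  define P where "P = point_measure S (\<lambda>s. ennreal (l s))"
  have "prob_space P"
    unfolding P_def
    by (rule prob_space_point_measure) (use finS l_nonneg sum_l in \<open>simp_all add: sum_ennreal\<close>)
  moreover have "sets P = sets (count_space S)" by (simp add: P_def sets_point_measure)
  moreover have "(\<lambda>N. total_variation (?\<nu> N) P) \<longlonglongrightarrow> 0"
  proof (rule Lim_null_comparison)
    show "\<forall>\<^sub>F N in sequentially. norm (total_variation (?\<nu> N) P) \<le> (\<Sum>s\<in>S. \<bar>q N s - l s\<bar>)"
      using good
    proof eventually_elim
      case (elim N)
      have "measure P B = (\<Sum>s\<in>B. l s)" if "B \<subseteq> S" for B
        using that finS l_nonneg by (simp add: P_def measure_point_measure_finite_if)
      then show ?case
        using elim unfolding real_norm_def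
        by (intro total_variation_le_sum finS \<nu>_measure) auto
    qed
    have "(\<lambda>N. \<Sum>s\<in>S. \<bar>q N s - l s\<bar>) \<longlonglongrightarrow> (\<Sum>s\<in>S. \<bar>l s - l s\<bar>)"
      by (intro tendsto_intros l)
    then show "(\<lambda>N. \<Sum>s\<in>S. \<bar>q N s - l s\<bar>) \<longlonglongrightarrow> 0" by simp
  qed
  moreover have "\<forall>\<^sub>F N in sequentially. prob_space (?\<mu> N) \<and> truncate_tree n \<in> measurable (?\<mu> N) (count_space S)"
    using good by eventually_elim (use prob meas in blast)
  ultimately show "(\<forall>\<^sub>F N in sequentially. prob_space (?\<mu> N) \<and>
        truncate_tree n \<in> measurable (?\<mu> N) (count_space (trees_of_height D n))) \<and>
    (\<exists>P. prob_space P \<and> sets P = sets (count_space (trees_of_height D n)) \<and>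
        (\<lambda>N. total_variation (distr (?\<mu> N) (count_space (trees_of_height D n)) (truncate_tree n)) P) \<longlonglongrightarrow> 0)"
    unfolding S_def by blast
qed

end
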